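(* Let $k$ be a positive integer. Every $(2k+1)$-connected semicomplete digraph $D$ with $\delta^+(D)\ge 10^7k^4$ is $k$-linked.
   Context: All digraphs are finite and simple. A semicomplete digraph is a digraph in which every pair of distinct vertices is joined by at least one arc (possibly one in each direction). A digraph is $k$-connected if it has at least $k+1$ vertices and, for every set $S$ of at most $k-1$ vertices and every pair of distinct vertices $x,y\notin S$, there is a directed path from $x$ to $y$ in $D-S$. A digraph $D$ is $k$-linked if for every $2k$-tuple $x_1,\dots,x_k,y_1,\dots,y_k$ of distinct vertices of $D$ there exist $k$ pairwise vertex-disjoint directed paths $P_1,\dots,P_k$ with $P_i$ starting at $x_i$ and ending at $y_i$ for each $i\in[k]$. $\delta^+(D)$ denotes the minimum out-degree of $D$. *)

theory Defs
  imports Main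
begin

definition digraph :: "'a set \<Rightarrow> ('a \<times> 'a) set \<Rightarrow> bool" where
  "digraph V A \<longleftrightarrow> finite V \<and> A \<subseteq> V \<times> V \<and> (\<forall>v. (v, v) \<notin> A)"

definition semicomplete :: "'a set \<Rightarrow> ('a \<times> 'a) set \<Rightarrow> bool" where
  "semicomplete V A \<longleftrightarrow> digraph V A \<and>
     (\<forall>x\<in>V. \<forall>y\<in>V. x \<noteq> y \<longrightarrow> (x, y) \<in> A \<or> (y, x) \<in> A)"

definition dpath :: "('a \<times> 'a) set \<Rightarrow> 'a list \<Rightarrow> bool" where
  "dpath A p \<longleftrightarrow> p \<noteq> [] \<and> distinct p \<and>
     (\<forall>i. Suc i < length p \<longrightarrow> (p ! i, p ! Suc i) \<in> A)"

definition path_avoiding :: "'a set \<Rightarrow> ('a \<times> 'a) set \<Rightarrow> 'a set \<Rightarrow> 'a \<Rightarrow> 'a \<Rightarrow> 'a list \<Rightarrow> bool" where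
  "path_avoiding V A S x y p \<longleftrightarrow> dpath A p \<and> set p \<subseteq> V - S \<and> hd p = x \<and> last p = y"

definition k_connected :: "nat \<Rightarrow> 'a set \<Rightarrow> ('a \<times> 'a) set \<Rightarrow> bool" where
  "k_connected k V A \<longleftrightarrow> card V \<ge> k + 1 \<and>
     (\<forall>S \<subseteq> V. card S \<le> k - 1 \<longrightarrow>
        (\<forall>x\<in>V - S. \<forall>y\<in>V - S. x \<noteq> y \<longrightarrow> (\<exists>p. path_avoiding V A S x y p)))"

definition out_degree :: "'a set \<Rightarrow> ('a \<times> 'a) set \<Rightarrow> 'a \<Rightarrow> nat" where
  "out_degree V A v = card {w \<in> V. (v, w) \<in> A}"

definition min_out_degree :: "'a set \<Rightarrow> ('a \<times> 'a) set \<Rightarrow> nat" where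
  "min_out_degree V A = Min (out_degree V A ` V)"

definition k_linked :: "nat \<Rightarrow> 'a set \<Rightarrow> ('a \<times> 'a) set \<Rightarrow> bool" where
  "k_linked k V A \<longleftrightarrow>
     (\<forall>x y :: nat \<Rightarrow> 'a.
        (\<forall>i<k. x i \<in> V \<and> y i \<in> V) \<and>
        inj_on (\<lambda>j. if j < k then x j else y (j - k)) {..<2*k} \<longrightarrow>
        (\<exists>P :: nat \<Rightarrow> 'a list.
           (\<forall>i<k. path_avoiding V A {} (x i) (y i) (P i)) \<and>
           (\<forall>i<k. \<forall>j<k. i \<noteq> j \<longrightarrow> set (P i) \<inter> set (P j) = {})))"

end

theory Submission
  imports Defs
begin

text \<open>
  Let \<open>X\<close> and \<open>Y\<close> be the sets of sources and sinks. A set \<open>W\<close> of vertices of lowest out-degree (in a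
  spanning tournament) can be reached robustly from everywhere, so it suffices to route
  \<open>x\<^sub>i\<close> to \<open>W\<close>, to take \<open>k\<close> disjoint paths from \<open>W\<close> to \<open>Y\<close> of minimal total length, and to connect the
  two: minimality forces a vertex of \<open>W\<close> that is off the paths to send arcs only to the first two
  vertices of each path, so there is room for the connections.

  The first steps from \<open>X\<close> have to be reserved before the paths to \<open>Y\<close> are chosen, without destroying
  the connectivity. By \<open>(2k+1)\<close>-connectivity there are \<open>k + 1\<close> disjoint paths, again of
  minimal total length, from \<open>W\<close> to a set \<open>Z\<close> of vertices of lowest in-degree in \<open>D - X\<close>. If \<open>x\<^sub>i\<close> has
  many out-neighbours off these paths, then it can be routed to \<open>W\<close> off the paths. Otherwise \<open>x\<^sub>i\<close> has many
  out-neighbours on one path; one of them, \<open>b\<^sub>i\<close>, is reserved, and it dominates the unused part of \<open>W\<close>.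
  If deleting the reserved vertices left no \<open>k\<close> disjoint paths from \<open>W\<close> to \<open>Y\<close>, then two vertices
  \<open>b\<^sub>i\<close>, \<open>b\<^sub>j\<close> on different paths would lie on a common cut. By minimality, the pairs of positions on
  two paths that admit such a cut form a monotone staircase, hence there are few of them, and the
  \<open>b\<^sub>i\<close> can be chosen greedily so that no such pair occurs.
\<close>

subsection \<open>Menger's theorem\<close>

definition walk :: "('a \<times> 'a) set \<Rightarrow> 'a list \<Rightarrow> bool" where
  "walk E p \<longleftrightarrow> p \<noteq> [] \<and> successively (\<lambda>u v. (u, v) \<in> E) p"

lemma dpath_iff_walk: "dpath E p \<longleftrightarrow> walk E p \<and> distinct p"
  by (auto simp: dpath_def walk_def successively_conv_nth)

lemma walk_singleton [simp]: "walk E [v]"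
  by (simp add: walk_def)

lemma walk_Cons: "p \<noteq> [] \<Longrightarrow> walk E (v # p) \<longleftrightarrow> (v, hd p) \<in> E \<and> walk E p"
  by (cases p) (auto simp: walk_def)

lemma walk_append:
  "p \<noteq> [] \<Longrightarrow> q \<noteq> [] \<Longrightarrow> walk E (p @ q) \<longleftrightarrow> walk E p \<and> walk E q \<and> (last p, hd q) \<in> E"
  by (auto simp: walk_def successively_append_iff)

lemma walk_mono: "walk E p \<Longrightarrow> E \<subseteq> E' \<Longrightarrow> walk E' p"
  unfolding walk_def using successively_mono[of "\<lambda>u v. (u, v) \<in> E" p "\<lambda>u v. (u, v) \<in> E'"] by blast

lemma dpath_mono: "dpath E p \<Longrightarrow> E \<subseteq> E' \<Longrightarrow> dpath E' p"
  by (auto simp: dpath_def)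

lemma walk_restrict: "walk E p \<Longrightarrow> set p \<subseteq> H \<Longrightarrow> walk (E \<inter> H \<times> H) p"
  by (auto simp: walk_def successively_conv_nth subset_iff)

text \<open>By induction: if the first vertex recurs on the path obtained for the rest, that path is
  cut off in front of the recurrence; otherwise the vertex is prepended.\<close>

lemma walk_imp_dpath:
  assumes "walk E w"
  shows "\<exists>p. dpath E p \<and> set p \<subseteq> set w \<and> hd p = hd w \<and> last p = last w"
  using assms
proof (induction w)
  case Nil
  then show ?case by (simp add: walk_def)
next
  case (Cons v w)
  show ?case
  proof (cases "w = []")
    case True
    then show ?thesis by (intro exI[of _ "[v]"]) (auto simp: dpath_def)
  next
    case False
    with Cons.prems have e: "(v, hd w) \<in> E" "walk E w" by (auto simp: walk_Cons)
    with Cons.IH obtain p where p: "dpath E p" "set p \<subseteq> set w" "hd p = hd w" "last p = last w"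
      by auto
    have ne: "p \<noteq> []" using p(1) by (simp add: dpath_def)
    show ?thesis
    proof (cases "v \<in> set p")
      case True
      then obtain a b where ab: "p = a @ v # b" by (meson split_list)
      have "walk E (v # b)" "distinct (v # b)"
        using p(1) ab by (auto simp: dpath_iff_walk walk_def successively_append_iff)
      then show ?thesis using p ab False
        by (intro exI[of _ "v # b"]) (auto simp: dpath_iff_walk)
    next
      case vn: False
      then show ?thesis using p e ne False
        by (intro exI[of _ "v # p"]) (auto simp: dpath_iff_walk walk_Cons)
    qed
  qed
qed

lemma walk_take: "walk E p \<Longrightarrow> 0 < n \<Longrightarrow> walk E (take n p)"
  by (auto simp: walk_def successively_conv_nth)

lemma walk_drop: "walk E p \<Longrightarrow> n < length p \<Longrightarrow> walk E (drop n p)"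
  by (auto simp: walk_def successively_conv_nth)

section \<open>Linkages and separators, with Menger's theorem in its set version\<close>

text \<open>The paths carry no indices: they are nonempty and disjoint, so \<open>card P\<close>
  counts them. One-vertex paths are allowed, and inner vertices may lie in \<open>S\<close> or
  \<open>T\<close>.\<close>

definition linkage :: "('a \<times> 'a) set \<Rightarrow> 'a set \<Rightarrow> 'a set \<Rightarrow> 'a list set \<Rightarrow> bool" where
  "linkage E S T P \<longleftrightarrow> finite P \<and> (\<forall>p\<in>P. dpath E p \<and> hd p \<in> S \<and> last p \<in> T) \<and>
     (\<forall>p\<in>P. \<forall>q\<in>P. p \<noteq> q \<longrightarrow> set p \<inter> set q = {})"

lemma linkage_mono: "linkage E S T P \<Longrightarrow> E \<subseteq> E' \<Longrightarrow> linkage E' S T P"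
  unfolding linkage_def using dpath_mono by blast

text \<open>\<open>C\<close> may contain vertices of \<open>S\<close> and \<open>T\<close>, so both
  sets are themselves separators.\<close>

definition separates :: "('a \<times> 'a) set \<Rightarrow> 'a set \<Rightarrow> 'a set \<Rightarrow> 'a set \<Rightarrow> bool" where
  "separates E S T C \<longleftrightarrow> (\<forall>p. dpath E p \<longrightarrow> hd p \<in> S \<longrightarrow> last p \<in> T \<longrightarrow> set p \<inter> C \<noteq> {})"

lemma separates_walk:
  "separates E S T C \<Longrightarrow> walk E p \<Longrightarrow> hd p \<in> S \<Longrightarrow> last p \<in> T \<Longrightarrow> set p \<inter> C \<noteq> {}"
  using walk_imp_dpath[of E p] unfolding separates_def by (metis inf_mono order_refl subset_empty)

text \<open>Disjoint paths have different last vertices, so \<open>card P = card T\<close> turns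
  \<open>last\<close> into a bijection. It serves to index paths by their ends, here and later for
  the targets \<open>y i\<close>.\<close>

lemma linkage_ends:
  assumes L: "linkage E S T P" and "card P = card T" "finite T"
  shows "\<exists>p. (\<forall>t\<in>T. p t \<in> P \<and> last (p t) = t) \<and> P = p ` T"
proof -
  have inj: "inj_on last P"
  proof (rule inj_onI)
    fix p q assume pq: "p \<in> P" "q \<in> P" "last p = last q"
    then have "last p \<in> set p \<inter> set q" using L
      by (metis IntI dpath_def last_in_set linkage_def)
    then show "p = q" using L pq by (auto simp: linkage_def)
  qed
  have "last ` P \<subseteq> T" using L by (auto simp: linkage_def)
  moreover have "card (last ` P) = card T" using inj assms by (simp add: card_image)
  ultimately have "last ` P = T" using assms by (meson card_subset_eq)
  then have b: "bij_betw last P T" using inj by (simp add: bij_betw_def)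
  show ?thesis
    using b by (intro exI[of _ "inv_into P last"])
      (auto simp: bij_betw_def inv_into_into f_inv_into_f image_image inv_into_f_f
         intro: inv_into_f_f[symmetric])
qed

lemma linkage_starts:
  assumes L: "linkage E S T P" and "card P = card S" "finite S"
  shows "\<exists>p. (\<forall>t\<in>S. p t \<in> P \<and> hd (p t) = t) \<and> P = p ` S"
proof -
  have inj: "inj_on hd P"
  proof (rule inj_onI)
    fix p q assume pq: "p \<in> P" "q \<in> P" "hd p = hd q"
    then have "hd p \<in> set p \<inter> set q" using L
      by (metis IntI dpath_def hd_in_set linkage_def)
    then show "p = q" using L pq by (auto simp: linkage_def)
  qed
  have "hd ` P \<subseteq> S" using L by (auto simp: linkage_def)
  moreover have "card (hd ` P) = card S" using inj assms by (simp add: card_image)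
  ultimately have "hd ` P = S" using assms by (meson card_subset_eq)
  then have b: "bij_betw hd P S" using inj by (simp add: bij_betw_def)
  show ?thesis
    using b by (intro exI[of _ "inv_into P hd"])
      (auto simp: bij_betw_def inv_into_into f_inv_into_f image_image inv_into_f_f
         intro: inv_into_f_f[symmetric])
qed

text \<open>Stop a path from \<open>A\<close> to \<open>B\<close> at its first vertex in
  \<open>insert x S\<close>: the arc \<open>(x, y)\<close> has not been used yet, so
  \<open>C\<close> meets this segment. Such a vertex exists, because a path missing \<open>x\<close>
  and \<open>S\<close> would survive the deletion of the arc and contradict
  \<open>S\<close>.\<close>

lemma separates_via_source:
  assumes S: "separates (E - {(x, y)}) A B S" and C: "separates (E - {(x, y)}) A (insert x S) C"
  shows "separates E A B C"
  unfolding separates_def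
proof (intro allI impI)
  fix p assume p: "dpath E p" "hd p \<in> A" "last p \<in> B"
  let ?Q = "\<lambda>i. i < length p \<and> p ! i \<in> insert x S"
  have ex: "\<exists>i. ?Q i"
  proof (rule ccontr)
    assume n: "\<nexists>i. ?Q i"
    have "dpath (E - {(x, y)}) p" using p(1) n by (auto simp: dpath_def)
    then have "set p \<inter> S \<noteq> {}" using S p by (auto simp: separates_def)
    then show False using n by (auto simp: in_set_conv_nth)
  qed
  define i where "i = (LEAST i. ?Q i)"
  have i: "?Q i" using LeastI_ex[OF ex] by (simp add: i_def)
  have least: "\<not> ?Q j" if "j < i" for j using that not_less_Least i_def by metis
  have "dpath (E - {(x, y)}) (take (Suc i) p)"
    using p(1) i least by (auto simp: dpath_def less_Suc_eq)
  moreover have "hd (take (Suc i) p) \<in> A" using p by (cases p) auto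
  moreover have "last (take (Suc i) p) = p ! i" using i by (simp add: take_Suc_conv_app_nth)
  ultimately have "set (take (Suc i) p) \<inter> C \<noteq> {}" using C i by (auto simp: separates_def)
  then show "set p \<inter> C \<noteq> {}" using set_take_subset[of "Suc i" p] by blast
qed

lemma dpath_rev: "dpath (E\<inverse>) (rev p) \<longleftrightarrow> dpath E p"
  by (auto simp: dpath_iff_walk walk_def)

lemma separates_converse: "separates (E\<inverse>) B A C \<longleftrightarrow> separates E A B C"
proof -
  have *: "separates (E\<inverse>) B A C" if "separates E A B C" for E :: "('a \<times> 'a) set" and A B
    unfolding separates_def
  proof (intro allI impI)
    fix p assume p: "dpath (E\<inverse>) p" "hd p \<in> B" "last p \<in> A"
    have "dpath E (rev p)" using p(1) dpath_rev[of "E" "rev p"] by simp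
    then show "set p \<inter> C \<noteq> {}" using that p
      by (metis hd_rev last_rev separates_def set_rev)
  qed
  show ?thesis using *[of E A B] *[of "E\<inverse>" B A] by auto
qed

lemma separates_via_target:
  assumes S: "separates (E - {(x, y)}) A B S" and C: "separates (E - {(x, y)}) (insert y S) B C"
  shows "separates E A B C"
proof -
  have c: "(E - {(x, y)})\<inverse> = E\<inverse> - {(y, x)}" by auto
  show ?thesis
    using separates_via_source[of "E\<inverse>" y x B A S C] S C
    by (simp add: separates_converse flip: c)
qed

text \<open>Induction on the number of arcs. If deleting an arc \<open>(x, y)\<close> creates a
  separator \<open>S\<close> with fewer than \<open>k\<close> vertices, it has exactly
  \<open>k - 1\<close>, and the induction hypothesis gives \<open>k\<close> paths from
  \<open>A\<close> to \<open>insert x S\<close> and \<open>k\<close> from \<open>insert y S\<close>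
  to \<open>B\<close>, which are glued at \<open>S\<close> and along the arc.\<close>

theorem menger:
  assumes "finite E" "finite A" "\<And>C. finite C \<Longrightarrow> separates E A B C \<Longrightarrow> k \<le> card C"
  shows "\<exists>P. linkage E A B P \<and> card P = k"
  using assms
proof (induction "card E" arbitrary: E A B k rule: less_induct)
  case less
  show ?case
  proof (cases "E = {}")
    case True
    have "separates E A B (A \<inter> B)" unfolding separates_def
    proof (intro allI impI)
      fix p assume p: "dpath E p" "hd p \<in> A" "last p \<in> B"
      then have "length p = 1" using True
        by (metis One_nat_def Suc_lessI dpath_def empty_iff length_greater_0_conv)
      then have "p = [hd p]" by (cases p) auto
      then show "set p \<inter> (A \<inter> B) \<noteq> {}" using p
        by (metis IntI disjoint_iff last_ConsL list.set_intros(1))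
    qed
    then have "k \<le> card (A \<inter> B)" using less by auto
    then obtain K where K: "K \<subseteq> A \<inter> B" "card K = k" "finite K"
      by (metis obtain_subset_with_card_n)
    have "card ((\<lambda>v. [v]) ` K) = k" using K by (simp add: card_image inj_on_def)
    moreover have "linkage E A B ((\<lambda>v. [v]) ` K)"
      using K by (auto simp: linkage_def dpath_def)
    ultimately show ?thesis by blast
  next
    case False
    then obtain x y where xy: "(x, y) \<in> E" by auto
    define E' where "E' = E - {(x, y)}"
    have cE: "card E' < card E" "finite E'" "E' \<subseteq> E"
      using less.prems(1) card_Diff1_less[OF less.prems(1) xy] unfolding E'_def by auto
    show ?thesis
    proof (cases "\<exists>S. finite S \<and> separates E' A B S \<and> card S < k")
      case False
      then have "\<exists>P. linkage E' A B P \<and> card P = k"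
        using less.hyps[OF cE(1,2) less.prems(2)] by (meson not_le)
      then show ?thesis using cE(3) linkage_mono by blast
    next
      case True
      then obtain S where S: "finite S" "separates E' A B S" "card S < k" by auto
      have sx: "k \<le> card C" if "finite C" "separates E' A (insert x S) C" for C
        using that separates_via_source S(2) less.prems(3) unfolding E'_def by metis
      have sy: "k \<le> card C" if "finite C" "separates E' (insert y S) B C" for C
        using that separates_via_target S(2) less.prems(3) unfolding E'_def by metis
      \<comment> \<open>Each of the two sets separates trivially, so both have at least
        \<open>k\<close> vertices; with \<open>card S < k\<close> this leaves only
        \<open>card S = k - 1\<close> and \<open>x\<close>, \<open>y\<close> outside
        \<open>S\<close>.\<close>
      have "separates E' A (insert x S) (insert x S)" "separates E' (insert y S) B (insert y S)"
        by (force simp: separates_def dpath_def)+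
      then have "k \<le> card (insert x S)" "k \<le> card (insert y S)"
        using sx sy S(1) by auto
      then have kx: "card (insert x S) = k" "x \<notin> S" and ky: "card (insert y S) = k" "y \<notin> S"
        using S by (auto simp: card_insert_if split: if_splits)
      obtain P Q where P: "linkage E' A (insert x S) P" "card P = k"
        and Q: "linkage E' (insert y S) B Q" "card Q = k"
        using less.hyps[OF cE(1,2) less.prems(2) sx]
          less.hyps[OF cE(1,2) _ sy] S(1) by blast
      obtain p where p: "\<forall>t\<in>insert x S. p t \<in> P \<and> last (p t) = t" "P = p ` insert x S"
        using linkage_ends[OF P(1)] P kx S by auto
      obtain q where q: "\<forall>t\<in>insert y S. q t \<in> Q \<and> hd (q t) = t" "Q = q ` insert y S"
        using linkage_starts[OF Q(1)] Q ky S by auto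
      have pd: "dpath E' (p t)" "hd (p t) \<in> A" "p t \<noteq> []" "distinct (p t)" "t \<in> set (p t)"
        if "t \<in> insert x S" for t
      proof -
        have "p t \<in> P" "last (p t) = t" using that p(1) by auto
        then show "dpath E' (p t)" "hd (p t) \<in> A" "p t \<noteq> []" "distinct (p t)" "t \<in> set (p t)"
          using P(1) last_in_set[of "p t"] unfolding linkage_def dpath_def by metis+
      qed
      have qd: "dpath E' (q t)" "last (q t) \<in> B" "q t \<noteq> []" "distinct (q t)" "t \<in> set (q t)"
        if "t \<in> insert y S" for t
      proof -
        have "q t \<in> Q" "hd (q t) = t" using that q(1) by auto
        then show "dpath E' (q t)" "last (q t) \<in> B" "q t \<noteq> []" "distinct (q t)" "t \<in> set (q t)"
          using Q(1) hd_in_set[of "q t"] unfolding linkage_def dpath_def by metis+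
      qed
      have pp: "t = t'" if "t \<in> insert x S" "t' \<in> insert x S" "v \<in> set (p t)" "v \<in> set (p t')" for t t' v
        using that p(1) P(1) unfolding linkage_def by (metis disjoint_iff)
      have qq: "t = t'" if "t \<in> insert y S" "t' \<in> insert y S" "v \<in> set (q t)" "v \<in> set (q t')" for t t' v
        using that q(1) Q(1) unfolding linkage_def by (metis disjoint_iff)
      \<comment> \<open>The two families meet only in \<open>S\<close>: a common vertex
        \<open>v\<close> yields a walk from \<open>A\<close> to \<open>B\<close> without the deleted
        arc, which must meet \<open>S\<close>. As \<open>p t\<close> can meet \<open>S\<close> only
        in its end and \<open>q t'\<close> only in its start, the meeting vertex is
        \<open>v\<close>.\<close>
      have pq: "v = t \<and> v = t' \<and> v \<in> S"
        if v: "t \<in> insert x S" "t' \<in> insert y S" "v \<in> set (p t)" "v \<in> set (q t')" for t t' v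
      proof -
        obtain a b where ab: "p t = a @ v # b" using v(3) by (meson split_list)
        obtain c d where cd: "q t' = c @ v # d" using v(4) by (meson split_list)
        have w1: "walk E' (a @ [v])" "walk E' (v # d)"
          using pd(1)[OF v(1)] qd(1)[OF v(2)] ab cd
          by (auto simp: dpath_iff_walk walk_def successively_append_iff)
        then have "walk E' (a @ v # d)" by (cases "a = []") (auto simp: walk_append)
        moreover have "hd (a @ v # d) \<in> A" using pd(2)[OF v(1)] ab by (cases a) auto
        moreover have "last (a @ v # d) \<in> B" using qd(2)[OF v(2)] cd by auto
        ultimately have "set (a @ v # d) \<inter> S \<noteq> {}" using separates_walk[OF S(2)] by blast
        then obtain s where s: "s \<in> S" "s \<in> set a \<union> {v} \<union> set d" by auto
        have "s = v"
        proof (rule ccontr)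
          assume sv: "s \<noteq> v"
          then consider "s \<in> set a" | "s \<in> set d" using s by auto
          then show False
          proof cases
            case 1
            then have "s \<in> set (p t)" using ab by auto
            then have "s = t" using pp[of t s s] v(1) s(1) pd(5)[of s] by auto
            moreover have "t = last (v # b)" using ab p(1) v(1) by auto
            ultimately have "s \<in> set (v # b)" by (metis last_in_set list.distinct(1))
            then show False using 1 ab pd(4)[OF v(1)] by auto
          next
            case 2
            then have "s \<in> set (q t')" using cd by auto
            then have "s = t'" using qq[of t' s s] v(2) s(1) qd(5)[of s] by auto
            moreover have "t' = hd (c @ [v])" using cd q(1) v(2) by (cases c) auto
            ultimately have "s \<in> set (c @ [v])" by (metis hd_in_set snoc_eq_iff_butlast)
            then show False using 2 cd qd(4)[OF v(2)] by auto
          qed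
        qed
        then show ?thesis using pp[of t s s] qq[of t' s s] v s(1) pd(5)[of s] qd(5)[of s] by auto
      qed
      \<comment> \<open>At \<open>x\<close> the arc \<open>(x, y)\<close> is inserted; elsewhere
        both paths contain \<open>t\<close>, which \<open>tl\<close> keeps from being
        repeated.\<close>
      define f where "f t = (if t = x then p x @ q y else p t @ tl (q t))" for t
      have fset: "set (f t) = set (p t) \<union> set (q (if t = x then y else t))" if "t \<in> insert x S" for t
      proof (cases "t = x")
        case False
        then have "t \<in> S" using that by auto
        then have "q t = t # tl (q t)" using q(1) qd(3)[of t] by (metis insertCI list.collapse)
        then have "set (q t) = insert t (set (tl (q t)))" by (metis list.simps(15))
        then show ?thesis using False pd(5)[OF that] by (auto simp: f_def)
      qed (auto simp: f_def)
      have fd: "dpath E (f t) \<and> hd (f t) \<in> A \<and> last (f t) \<in> B" if t: "t \<in> insert x S" for t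
      proof (cases "t = x")
        case True
        have "walk E (p x)" "walk E (q y)"
          using pd(1)[of x] qd(1)[of y] cE(3) walk_mono by (auto simp: dpath_iff_walk)
        then have "walk E (f t)" using True xy p(1) q(1) pd(3)[of x] qd(3)[of y]
          by (auto simp: f_def walk_append)
        moreover have "set (p x) \<inter> set (q y) = {}" using pq[of x y] kx(2) by blast
        ultimately show ?thesis using True pd(2-4)[of x] qd(2-4)[of y]
          by (auto simp: f_def dpath_iff_walk)
      next
        case False
        then have tS: "t \<in> S" using t by auto
        then have qt: "q t = t # tl (q t)" using q(1) qd(3)[of t] by (metis insertCI list.collapse)
        have w: "walk E (p t)" "walk E (q t)"
          using pd(1)[of t] qd(1)[of t] tS cE(3) walk_mono by (auto simp: dpath_iff_walk)
        have "walk E (f t)"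
        proof (cases "tl (q t) = []")
          case True
          then show ?thesis using w False by (simp add: f_def)
        next
          case ne: False
          have "walk E (t # tl (q t))" using w(2) qt by simp
          then have "(t, hd (tl (q t))) \<in> E" "walk E (tl (q t))" using ne by (auto simp: walk_Cons)
          then show ?thesis using w(1) ne False p(1) t pd(3)[OF t] by (auto simp: f_def walk_append)
        qed
        moreover have "distinct (f t)"
        proof -
          have d: "distinct (t # tl (q t))" using qd(4)[of t] tS qt by simp
          have "set (p t) \<inter> set (tl (q t)) = {}"
          proof (rule ccontr)
            assume "set (p t) \<inter> set (tl (q t)) \<noteq> {}"
            then obtain v where v: "v \<in> set (p t)" "v \<in> set (tl (q t))" by auto
            then have "v \<in> set (q t)" using qd(3)[of t] tS by (auto dest: list.set_sel(2))
            then have "v = t" using pq[of t t v] v tS by auto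
            then show False using v d by auto
          qed
          then show ?thesis using d pd(4)[OF t] False by (simp add: f_def)
        qed
        moreover have "hd (f t) \<in> A" using pd(2,3)[OF t] False by (simp add: f_def)
        moreover have "last (f t) \<in> B"
        proof (cases "tl (q t) = []")
          case True
          then have "q t = [t]" using qt by simp
          then show ?thesis using qd(2)[of t] tS p(1) False True by (auto simp: f_def)
        next
          case ne: False
          then have "last (f t) = last (q t)" using False qt by (metis f_def last_ConsR last_appendR)
          then show ?thesis using qd(2)[of t] tS by auto
        qed
        ultimately show ?thesis by (simp add: dpath_iff_walk)
      qed
      have fdis: "set (f t) \<inter> set (f t') = {}"
        if t: "t \<in> insert x S" "t' \<in> insert x S" "t \<noteq> t'" for t t'
      proof (rule ccontr)
        assume "set (f t) \<inter> set (f t') \<noteq> {}"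
        then obtain v where v: "v \<in> set (f t)" "v \<in> set (f t')" by auto
        let ?g = "\<lambda>t. if t = x then y else t"
        have g: "?g t \<in> insert y S" "?g t' \<in> insert y S" "?g t \<noteq> ?g t'"
          using t ky(2) by auto
        from v fset[OF t(1)] fset[OF t(2)]
        consider "v \<in> set (p t)" "v \<in> set (p t')" | "v \<in> set (p t)" "v \<in> set (q (?g t'))"
          | "v \<in> set (q (?g t))" "v \<in> set (p t')" | "v \<in> set (q (?g t))" "v \<in> set (q (?g t'))"
          by blast
        then show False
        proof cases
          case 1
          then show False using pp t by metis
        next
          case 2
          then have "v = t" "v = ?g t'" "v \<in> S" using pq[OF t(1) g(2)] by blast+
          then show False using t(3) ky(2) by (cases "t' = x") auto
        next
          case 3
          then have "v = t'" "v = ?g t" "v \<in> S" using pq[OF t(2) g(1)] by blast+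
          then show False using t(3) ky(2) by (cases "t = x") auto
        next
          case 4
          then show False using qq g by metis
        qed
      qed
      have inj: "inj_on f (insert x S)"
      proof (rule inj_onI, rule ccontr)
        fix t t' assume t: "t \<in> insert x S" "t' \<in> insert x S" "f t = f t'" "t \<noteq> t'"
        then have "set (f t) = {}" using fdis[of t t'] by auto
        then show False using fset[OF t(1)] pd(5)[OF t(1)] by auto
      qed
      have "linkage E A B (f ` insert x S)"
      proof -
        have "set p \<inter> set q = {}"
          if pq: "p \<in> f ` insert x S" "q \<in> f ` insert x S" "p \<noteq> q" for p q
        proof -
          from pq obtain t t' where "t \<in> insert x S" "t' \<in> insert x S" "p = f t" "q = f t'" by blast
          then show ?thesis using fdis[of t t'] pq(3) by blast
        qed
        moreover have "finite (f ` insert x S)" using S(1) by simp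
        ultimately show ?thesis using fd unfolding linkage_def by blast
      qed
      moreover have "card (f ` insert x S) = k" by (simp only: card_image[OF inj] kx)
      ultimately show ?thesis by blast
    qed
  qed
qed

subsection \<open>Linkages of minimal total length\<close>

definition min_linkage :: "('a \<times> 'a) set \<Rightarrow> 'a set \<Rightarrow> 'a set \<Rightarrow> 'a list set \<Rightarrow> bool" where
  "min_linkage E S T P \<longleftrightarrow> linkage E S T P \<and>
     (\<forall>P'. linkage E S T P' \<and> card P' = card P \<longrightarrow> sum length P \<le> sum length P')"

lemma min_linkage_exists:
  assumes "linkage E S T P"
  shows "\<exists>P'. min_linkage E S T P' \<and> card P' = card P"
proof -
  let ?Q = "\<lambda>P'. linkage E S T P' \<and> card P' = card P"
  obtain P' where "?Q P'" "\<forall>P''. ?Q P'' \<longrightarrow> sum length P' \<le> sum length P''"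
    using ex_has_least_nat[of ?Q P "sum length"] assms by blast
  then show ?thesis unfolding min_linkage_def by metis
qed

text \<open>Paths are nonempty, so disjointness from the kept paths also makes \<open>Q'\<close> and
  \<open>P - Q\<close> disjoint as sets of lists. The length identity is additive to avoid truncated
  subtraction.\<close>

lemma linkage_replace:
  assumes L: "linkage E S T P" and Q: "Q \<subseteq> P" and L': "linkage E S T Q'" "card Q' = card Q"
    and dis: "(\<Union>q\<in>Q'. set q) \<inter> (\<Union>p\<in>P - Q. set p) = {}"
  shows "linkage E S T (P - Q \<union> Q')" "card (P - Q \<union> Q') = card P"
    "sum length (P - Q \<union> Q') + sum length Q = sum length P + sum length Q'"
proof -
  have fin: "finite P" "finite Q" "finite Q'" using assms finite_subset by (auto simp: linkage_def)
  have ne: "p \<noteq> []" if "p \<in> P \<union> Q'" for p using that L L' by (auto simp: linkage_def dpath_def)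
  have disj: "(P - Q) \<inter> Q' = {}"
  proof (rule ccontr)
    assume "(P - Q) \<inter> Q' \<noteq> {}"
    then obtain p where p: "p \<in> P" "p \<notin> Q" "p \<in> Q'" by auto
    then have "hd p \<in> set p" using ne by simp
    then show False using dis p by blast
  qed
  show "linkage E S T (P - Q \<union> Q')"
    unfolding linkage_def
  proof (intro conjI ballI impI)
    show "finite (P - Q \<union> Q')" using fin by simp
  next
    fix p assume "p \<in> P - Q \<union> Q'"
    then show "dpath E p" "hd p \<in> S" "last p \<in> T" using L L' by (auto simp: linkage_def)
  next
    fix p q assume "p \<in> P - Q \<union> Q'" "q \<in> P - Q \<union> Q'" "p \<noteq> q"
    then consider "p \<in> P" "q \<in> P" | "p \<in> P - Q" "q \<in> Q'" | "p \<in> Q'" "q \<in> P - Q" | "p \<in> Q'" "q \<in> Q'"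
      by blast
    then show "set p \<inter> set q = {}"
    proof cases
      case 1 then show ?thesis using L \<open>p \<noteq> q\<close> unfolding linkage_def by blast
    next
      case 2 then show ?thesis using dis by blast
    next
      case 3 then show ?thesis using dis by blast
    next
      case 4 then show ?thesis using L' \<open>p \<noteq> q\<close> unfolding linkage_def by blast
    qed
  qed
  have "card (P - Q \<union> Q') = card (P - Q) + card Q'" using fin disj by (simp add: card_Un_disjoint)
  then show "card (P - Q \<union> Q') = card P"
    using L'(2) Q fin card_mono[OF fin(1) Q] by (simp add: card_Diff_subset)
  have "sum length (P - Q \<union> Q') = sum length (P - Q) + sum length Q'"
    using fin disj by (simp add: sum.union_disjoint)
  moreover have "sum length P = sum length (P - Q) + sum length Q"
    using sum.subset_diff[OF Q fin(1)] .
  ultimately show "sum length (P - Q \<union> Q') + sum length Q = sum length P + sum length Q'" by simp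
qed

lemma min_linkage_replace:
  assumes "min_linkage E S T P" "Q \<subseteq> P" "linkage E S T Q'" "card Q' = card Q"
    "(\<Union>q\<in>Q'. set q) \<inter> (\<Union>p\<in>P - Q. set p) = {}"
  shows "sum length Q \<le> sum length Q'"
proof -
  have "linkage E S T P" using assms(1) by (simp add: min_linkage_def)
  note r = linkage_replace[OF this assms(2-5)]
  have "sum length P \<le> sum length (P - Q \<union> Q')" using assms(1) r by (simp add: min_linkage_def)
  then show ?thesis using r(3) by simp
qed

text \<open>Replacing the first \<open>s\<close> vertices of \<open>p\<close> by \<open>c\<close>
  gives another linkage of the same size. The empty \<open>c\<close> covers the case that
  \<open>p ! s\<close> is itself a source.\<close>

lemma min_linkage_shortcut:
  assumes M: "min_linkage E S T P" and p: "p \<in> P" "s < length p"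
    and c: "c = [] \<or> (dpath E c \<and> (last c, p ! s) \<in> E)" "hd (c @ [p ! s]) \<in> S"
    and dis: "set c \<inter> (\<Union>p\<in>P. set p) = {}"
  shows "s \<le> length c"
proof -
  have L: "linkage E S T P" using M by (simp add: min_linkage_def)
  have dp: "walk E p" "distinct p" "last p \<in> T" using L p by (auto simp: linkage_def dpath_iff_walk)
  let ?d = "drop s p"
  have hd: "hd ?d = p ! s" "?d \<noteq> []" using p(2) by (auto simp: hd_drop_conv_nth)
  have "walk E (c @ ?d)"
    using c(1) walk_drop[OF dp(1) p(2)] hd
    by (auto simp: walk_def dpath_iff_walk successively_append_iff)
  moreover have "distinct (c @ ?d)"
    using c(1) dp(2) dis p(1) set_drop_subset[of s p] by (fastforce simp: dpath_def)
  ultimately have d: "dpath E (c @ ?d)" by (simp add: dpath_iff_walk)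
  have "hd (c @ ?d) \<in> S" using c(2) hd by (cases c) auto
  moreover have "last (c @ ?d) \<in> T" using dp(3) hd p(2) by (auto simp: last_drop)
  ultimately have l: "linkage E S T {c @ ?d}" using d by (simp add: linkage_def)
  have "set (c @ ?d) \<inter> set q = {}" if q: "q \<in> P" "q \<noteq> p" for q
  proof -
    have "set p \<inter> set q = {}" using L q p unfolding linkage_def by blast
    then show ?thesis using dis q set_drop_subset[of s p] by auto
  qed
  then have "(\<Union>q\<in>{c @ ?d}. set q) \<inter> (\<Union>q\<in>P - {p}. set q) = {}" by auto
  from min_linkage_replace[OF M _ l _ this] have "length p \<le> length (c @ ?d)" using p(1) by simp
  then show ?thesis using p(2) by simp
qed

lemma min_linkage_source_index:
  assumes "min_linkage E S T P" "p \<in> P" "s < length p" "p ! s \<in> S"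
  shows "s = 0"
  using min_linkage_shortcut[OF assms(1-3), of "[]"] assms(4) by simp

text \<open>The case \<open>c = [w]\<close> of the shortcut. A free source thus loses at most two
  out-neighbours per path, which leaves room for connections off the paths.\<close>

lemma min_linkage_arc_index:
  assumes "min_linkage E S T P" "p \<in> P" "s < length p" "w \<in> S" "w \<notin> (\<Union>p\<in>P. set p)"
    "(w, p ! s) \<in> E"
  shows "s \<le> 1"
  using min_linkage_shortcut[OF assms(1-3), of "[w]"] assms(4-) by (simp add: dpath_iff_walk)

text \<open>The case \<open>c = [w, u]\<close>, which keeps the middle vertex of the connections in
  \<open>connect\<close> off the paths.\<close>

lemma min_linkage_arc2_index:
  assumes "min_linkage E S T P" "p \<in> P" "s < length p" "w \<in> S" "w \<notin> (\<Union>p\<in>P. set p)"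
    "u \<notin> (\<Union>p\<in>P. set p)" "w \<noteq> u" "(w, u) \<in> E" "(u, p ! s) \<in> E"
  shows "s \<le> 2"
  using min_linkage_shortcut[OF assms(1-3), of "[w, u]"] assms(4-)
  by (simp add: dpath_iff_walk walk_Cons numeral_2_eq_2)

text \<open>
  If positions \<open>s\<close> and \<open>t\<close> on two paths of the linkage both lie on one small cut, then everything
  behind the cut dominates everything in front of it. The two arcs below are the only trace of this
  that is kept: they make the notion independent of the cut.
\<close>

definition crossing :: "('a \<times> 'a) set \<Rightarrow> 'a list \<Rightarrow> nat \<Rightarrow> 'a list \<Rightarrow> nat \<Rightarrow> bool" where
  "crossing E p s q t \<longleftrightarrow> (p ! (s + 1), q ! (t - 1)) \<in> E \<and> (q ! (t + 1), p ! (s - 1)) \<in> E"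

lemma dpath_splice:
  assumes p: "dpath E p" "a < length p" and q: "dpath E q" "b < length q"
    and e: "(p ! a, q ! b) \<in> E" and d: "set p \<inter> set q = {}"
  shows "dpath E (take (Suc a) p @ drop b q)"
    "hd (take (Suc a) p @ drop b q) = hd p" "last (take (Suc a) p @ drop b q) = last q"
proof -
  have ne: "take (Suc a) p \<noteq> []" "drop b q \<noteq> []" using p q by (auto simp: dpath_def)
  have l: "last (take (Suc a) p) = p ! a" "hd (drop b q) = q ! b"
    using p q by (auto simp: take_Suc_conv_app_nth hd_drop_conv_nth)
  have "walk E (take (Suc a) p @ drop b q)"
    using ne l e p q by (simp add: walk_append dpath_iff_walk walk_take walk_drop)
  moreover have "distinct (take (Suc a) p @ drop b q)"
    using p(1) q(1) d set_take_subset[of "Suc a" p] set_drop_subset[of b q]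
    by (auto simp: dpath_def)
  ultimately show "dpath E (take (Suc a) p @ drop b q)" by (simp add: dpath_iff_walk)
  show "hd (take (Suc a) p @ drop b q) = hd p" using p by (cases p) (auto simp: dpath_def)
  show "last (take (Suc a) p @ drop b q) = last q" using ne q(2) by (simp add: last_drop)
qed

text \<open>Exchanging the tails of the two paths along the two arcs would shorten the linkage.\<close>

lemma min_linkage_no_double_crossing:
  assumes M: "min_linkage E S T P" and pq: "p \<in> P" "q \<in> P" "p \<noteq> q"
    and s: "s1 + 4 \<le> s2" "s2 < length p" and t: "t1 + 4 \<le> t2" "t2 < length q"
    and e: "(p ! (s1 + 1), q ! (t2 - 1)) \<in> E" "(q ! (t1 + 1), p ! (s2 - 1)) \<in> E"
  shows False
proof -
  have L: "linkage E S T P" using M by (simp add: min_linkage_def)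
  have dp: "dpath E p" "dpath E q" "hd p \<in> S" "hd q \<in> S" "last p \<in> T" "last q \<in> T"
    and dis: "set p \<inter> set q = {}"
    using L pq unfolding linkage_def by blast+
  let ?p = "take (Suc (s1 + 1)) p @ drop (t2 - 1) q"
  let ?q = "take (Suc (t1 + 1)) q @ drop (s2 - 1) p"
  have P: "dpath E ?p" "hd ?p = hd p" "last ?p = last q"
    using dpath_splice[OF dp(1) _ dp(2) _ e(1) dis] s t by auto
  have Q: "dpath E ?q" "hd ?q = hd q" "last ?q = last p"
    using dpath_splice[OF dp(2) _ dp(1) _ e(2)] dis s t by (auto simp: Int_commute)
  have sub: "set ?p \<subseteq> set p \<union> set q" "set ?q \<subseteq> set p \<union> set q"
    by (auto dest: in_set_takeD in_set_dropD)
  have d1: "set (take (Suc (s1 + 1)) p) \<inter> set (drop (s2 - 1) p) = {}"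
    using dp(1) s by (intro set_take_disj_set_drop_if_distinct) (auto simp: dpath_def)
  have d2: "set (take (Suc (t1 + 1)) q) \<inter> set (drop (t2 - 1) q) = {}"
    using dp(2) t by (intro set_take_disj_set_drop_if_distinct) (auto simp: dpath_def)
  have "set ?p \<inter> set ?q = {}"
    using d1 d2 dis by (auto dest: in_set_takeD in_set_dropD)
  moreover have "?p \<noteq> []" using P(1) by (simp add: dpath_def)
  ultimately have ne: "?p \<noteq> ?q" by (metis inf.idem set_empty)
  have l: "linkage E S T {?p, ?q}"
    using P Q dp \<open>set ?p \<inter> set ?q = {}\<close> unfolding linkage_def by auto
  have "(\<Union>r\<in>{?p, ?q}. set r) \<inter> (\<Union>r\<in>P - {p, q}. set r) = {}"
  proof -
    have "(set p \<union> set q) \<inter> set r = {}" if "r \<in> P - {p, q}" for r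
      using L that pq unfolding linkage_def by blast
    then show ?thesis using sub by blast
  qed
  from min_linkage_replace[OF M _ l _ this]
  have "length p + length q \<le> length ?p + length ?q" using pq ne by simp
  \<comment> \<open>The new paths have total length
    \<open>length p + length q + 6 - (s2 - s1) - (t2 - t1)\<close>, so gaps of 4 save at least two
    vertices.\<close>
  then show False using s t by simp
qed

section \<open>Counting conflicts and choosing greedily\<close>

text \<open>Remove the largest entry from each row \<open>{t \<in> B. C s t}\<close>. The reduced
  rows are disjoint, since a common \<open>t\<close> of rows \<open>s1 < s2\<close> and the maximum
  of row \<open>s1\<close> form the forbidden pattern. So they hold at most \<open>card B\<close>
  pairs, and at most \<open>card A\<close> were removed.\<close>

lemma staircase_card_le:
  fixes C :: "nat \<Rightarrow> nat \<Rightarrow> bool"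
  assumes "finite A" "finite B"
    and st: "\<And>s1 s2 t1 t2. \<lbrakk>s1 \<in> A; s2 \<in> A; t1 \<in> B; t2 \<in> B; s1 < s2; t1 < t2; C s2 t1; C s1 t2\<rbrakk> \<Longrightarrow> False"
  shows "card {(s, t). s \<in> A \<and> t \<in> B \<and> C s t} \<le> card A + card B"
proof -
  let ?N = "\<lambda>s. {t \<in> B. C s t}"
  let ?N' = "\<lambda>s. ?N s - {Max (?N s)}"
  have fin: "finite (?N s)" for s using assms by simp
  have eq: "{(s, t). s \<in> A \<and> t \<in> B \<and> C s t} = (SIGMA s:A. ?N s)" by auto
  have dis: "?N' s1 \<inter> ?N' s2 = {}" if ss: "s1 \<in> A" "s2 \<in> A" "s1 < s2" for s1 s2
  proof (rule ccontr)
    assume "?N' s1 \<inter> ?N' s2 \<noteq> {}"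
    then obtain t where t: "t \<in> ?N s1" "t \<noteq> Max (?N s1)" "t \<in> ?N s2" by blast
    then have "t < Max (?N s1)" using Max_ge[OF fin t(1)] by simp
    moreover have "Max (?N s1) \<in> ?N s1" using Max_in[OF fin] t(1) by blast
    ultimately show False using st[of s1 s2 t "Max (?N s1)"] ss t by auto
  qed
  have "card (\<Union>s\<in>A. ?N' s) = (\<Sum>s\<in>A. card (?N' s))"
  proof (rule card_UN_disjoint)
    show "\<forall>i\<in>A. \<forall>j\<in>A. i \<noteq> j \<longrightarrow> ?N' i \<inter> ?N' j = {}"
      using dis by (metis (no_types, lifting) inf_commute linorder_neqE_nat)
  qed (use assms in auto)
  moreover have "card (\<Union>s\<in>A. ?N' s) \<le> card B" using assms(2) by (intro card_mono) auto
  moreover have "(\<Sum>s\<in>A. card (?N s)) \<le> (\<Sum>s\<in>A. card (?N' s) + 1)"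
    using fin by (intro sum_mono) (simp add: card_Diff_singleton_if, linarith)
  moreover have "card (SIGMA s:A. ?N s) = (\<Sum>s\<in>A. card (?N s))"
    using assms(1) fin by simp
  moreover have "(\<Sum>s\<in>A. card (?N' s) + 1) = (\<Sum>s\<in>A. card (?N' s)) + card A"
    by (subst sum.distrib) simp
  ultimately show ?thesis unfolding eq by linarith
qed

lemma spaced_card_le:
  fixes C :: "nat \<Rightarrow> nat \<Rightarrow> bool"
  assumes "finite A" "finite B"
    and C: "\<And>s t t'. \<lbrakk>s \<in> A; t \<in> B; t' \<in> B; C s t; C s t'\<rbrakk> \<Longrightarrow> t = t'"
  shows "card {(s, t). s \<in> A \<and> t \<in> B \<and> C s t} \<le> card A"
proof -
  have "inj_on fst {(s, t). s \<in> A \<and> t \<in> B \<and> C s t}" using C by (auto simp: inj_on_def)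
  then show ?thesis using assms(1) by (intro card_inj_on_le[of fst]) auto
qed

text \<open>Averaging finds for one index a candidate that conflicts with few candidates of the
  others. Deleting those costs every other index at most \<open>2 * k\<close> candidates, exactly
  the drop of the required bound when one index is settled.\<close>

lemma conflict_free_choice:
  fixes Q :: "'i \<Rightarrow> 'b \<Rightarrow> 'i \<Rightarrow> 'b \<Rightarrow> bool"
  assumes "finite I" "card I \<le> k" and "\<And>i. i \<in> I \<Longrightarrow> finite (C i) \<and> card (C i) \<ge> 2 * k * card I + 1"
    and "\<And>i j A B. \<lbrakk>i \<in> I; j \<in> I; i \<noteq> j; A \<subseteq> C i; B \<subseteq> C j\<rbrakk> \<Longrightarrow>
           card {(s, t). s \<in> A \<and> t \<in> B \<and> Q i s j t} \<le> card A + card B"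
    and sym: "\<And>i s j t. Q i s j t \<Longrightarrow> Q j t i s"
  shows "\<exists>c. \<forall>i\<in>I. c i \<in> C i \<and> (\<forall>j\<in>I. i \<noteq> j \<longrightarrow> \<not> Q i (c i) j (c j))"
  using assms(1-4)
proof (induction I arbitrary: C rule: finite_induct)
  case empty
  then show ?case by simp
next
  case (insert i I)
  let ?m = "2 * k * card (insert i I) + 1"
  have m: "?m = 2 * k + (2 * k * card I + 1)" using insert.hyps by simp
  \<comment> \<open>Trimming all candidate sets to the same size \<open>?m\<close> turns the bound
    on conflicting pairs into \<open>2 * ?m\<close>: on average two conflicts per candidate and
    other index.\<close>
  have "\<exists>D. D \<subseteq> C j \<and> card D = ?m \<and> finite D" if "j \<in> insert i I" for j
    using insert.prems(2)[OF that] by (metis obtain_subset_with_card_n finite_subset)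
  then obtain D where D: "\<And>j. j \<in> insert i I \<Longrightarrow> D j \<subseteq> C j \<and> card (D j) = ?m \<and> finite (D j)"
    by metis
  have pairs: "card {(s, t). s \<in> D i \<and> t \<in> D j \<and> Q i s j t} \<le> 2 * ?m" if "j \<in> I" for j
    using insert.prems(3)[of i j "D i" "D j"] that insert.hyps D by force
  let ?w = "\<lambda>s. \<Sum>j\<in>I. card {t \<in> D j. Q i s j t}"
  have "(\<Sum>s\<in>D i. ?w s) = (\<Sum>j\<in>I. \<Sum>s\<in>D i. card {t \<in> D j. Q i s j t})"
    by (rule sum.swap)
  also have "\<dots> = (\<Sum>j\<in>I. card {(s, t). s \<in> D i \<and> t \<in> D j \<and> Q i s j t})"
  proof (rule sum.cong)
    fix j assume "j \<in> I"
    have "{(s, t). s \<in> D i \<and> t \<in> D j \<and> Q i s j t} = (SIGMA s:D i. {t \<in> D j. Q i s j t})" by auto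
    then show "(\<Sum>s\<in>D i. card {t \<in> D j. Q i s j t}) = card {(s, t). s \<in> D i \<and> t \<in> D j \<and> Q i s j t}"
      using D[of i] D[of j] \<open>j \<in> I\<close> by simp
  qed simp
  also have "\<dots> \<le> (\<Sum>j\<in>I. 2 * ?m)" by (intro sum_mono pairs)
  also have "\<dots> = card (D i) * (2 * card I)" using D[of i] by simp
  finally have tot: "(\<Sum>s\<in>D i. ?w s) \<le> card (D i) * (2 * card I)" .
  have "\<exists>s\<in>D i. ?w s \<le> 2 * card I"
  proof (rule ccontr)
    assume "\<not> ?thesis"
    then have "(\<Sum>s\<in>D i. 2 * card I + 1) \<le> (\<Sum>s\<in>D i. ?w s)" by (intro sum_mono) force
    then show False using tot D[of i] by simp
  qed
  then obtain s where s: "s \<in> D i" "?w s \<le> 2 * card I" by blast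
  define C' where "C' j = D j - {t \<in> D j. Q i s j t}" for j
  have cI: "card I \<le> k" using insert.prems(1) insert.hyps by simp
  have "card {t \<in> D j. Q i s j t} \<le> 2 * k" if "j \<in> I" for j
  proof -
    have "card {t \<in> D j. Q i s j t} \<le> ?w s" using that insert.hyps(1) by (intro member_le_sum) auto
    then show ?thesis using s(2) cI by linarith
  qed
  then have "finite (C' j) \<and> card (C' j) \<ge> 2 * k * card I + 1" if "j \<in> I" for j
    using that D[of j] m unfolding C'_def by (subst card_Diff_subset) (auto, force)
  moreover have "C' j \<subseteq> C j" if "j \<in> I" for j using D[of j] that by (auto simp: C'_def)
  ultimately have "\<exists>c. \<forall>j\<in>I. c j \<in> C' j \<and> (\<forall>l\<in>I. j \<noteq> l \<longrightarrow> \<not> Q j (c j) l (c l))"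
    using insert.prems(3) cI by (intro insert.IH) (auto, meson subset_trans)
  then obtain c where c: "\<And>j. j \<in> I \<Longrightarrow> c j \<in> C' j \<and> (\<forall>l\<in>I. j \<noteq> l \<longrightarrow> \<not> Q j (c j) l (c l))"
    by blast
  have "\<not> Q i s j (c j)" "\<not> Q j (c j) i s" "c j \<in> C j" if "j \<in> I" for j
    using c[OF that] sym D[of j] that by (auto simp: C'_def)
  then show ?case using c s D[of i] insert.hyps(2)
    by (intro exI[of _ "c(i := s)"]) auto
qed

text \<open>The lists are chosen one after another; \<open>F\<close> stands for the vertices taken
  so far.\<close>

lemma greedy_disjoint_lists:
  assumes "finite I"
    and ex: "\<And>i F. \<lbrakk>i \<in> I; finite F; card F \<le> c * card I\<rbrakk> \<Longrightarrow>
      \<exists>l. length l \<le> c \<and> set l \<inter> F = {} \<and> Q i l"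
  shows "\<exists>l. (\<forall>i\<in>I. length (l i) \<le> c \<and> Q i (l i)) \<and>
    (\<forall>i\<in>I. \<forall>j\<in>I. i \<noteq> j \<longrightarrow> set (l i) \<inter> set (l j :: 'b list) = {})"
proof -
  have "\<exists>l. (\<forall>i\<in>J. length (l i) \<le> c \<and> Q i (l i)) \<and>
    (\<forall>i\<in>J. \<forall>j\<in>J. i \<noteq> j \<longrightarrow> set (l i) \<inter> set (l j :: 'b list) = {})" if "J \<subseteq> I" for J
    using finite_subset[OF that assms(1)] that
  proof (induction J rule: finite_induct)
    case empty
    then show ?case by simp
  next
    case (insert i J)
    then obtain l where l: "\<forall>i\<in>J. length (l i) \<le> c \<and> Q i (l i)"
      "\<forall>i\<in>J. \<forall>j\<in>J. i \<noteq> j \<longrightarrow> set (l i) \<inter> set (l j) = {}" by auto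
    let ?F = "\<Union>j\<in>J. set (l j)"
    have "card ?F \<le> (\<Sum>j\<in>J. card (set (l j)))" using insert.hyps(1) by (rule card_UN_le)
    also have "\<dots> \<le> (\<Sum>j\<in>J. c)" using l(1) card_length le_trans by (intro sum_mono) blast
    also have "\<dots> \<le> c * card I"
      using card_mono[OF assms(1), of J] insert.prems by simp
    finally obtain m where m: "length m \<le> c" "set m \<inter> ?F = {}" "Q i m"
      using ex[of i ?F] insert.prems insert.hyps(1) by auto
    have "set m \<inter> set (l j) = {}" "j \<noteq> i" if "j \<in> J" for j using m(2) insert.hyps(2) that by auto
    then show ?case using l m
      by (intro exI[of _ "l(i := m)"]) (simp add: Int_commute)
  qed
  then show ?thesis by blast
qed

subsection \<open>Tournaments and small cuts\<close>

definition tournament :: "'a set \<Rightarrow> ('a \<times> 'a) set \<Rightarrow> bool" where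
  "tournament V T \<longleftrightarrow> finite V \<and> T \<subseteq> V \<times> V \<and> (\<forall>u v. (u, v) \<in> T \<longrightarrow> (v, u) \<notin> T) \<and>
     (\<forall>u\<in>V. \<forall>v\<in>V. u \<noteq> v \<longrightarrow> (u, v) \<in> T \<or> (v, u) \<in> T)"

lemma tournament_converse: "tournament V T \<Longrightarrow> tournament V (T\<inverse>)"
  unfolding tournament_def by blast

lemma tournament_finite_Image:
  assumes "tournament V T"
  shows "finite (T `` B)" "finite (T\<inverse> `` B)"
proof -
  have "finite T" using assms finite_subset[of T "V \<times> V"] by (simp add: tournament_def)
  then show "finite (T `` B)" "finite (T\<inverse> `` B)"
    by (simp_all add: finite_Image)
qed

text \<open>Of two opposite arcs, the one that increases an injective numbering \<open>f\<close> of
  the vertices is kept.\<close>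

lemma semicomplete_tournament:
  assumes "semicomplete V A"
  shows "\<exists>T\<subseteq>A. tournament V T"
proof -
  have V: "finite V" "A \<subseteq> V \<times> V" "\<And>v. (v, v) \<notin> A"
    "\<And>u v. u \<in> V \<Longrightarrow> v \<in> V \<Longrightarrow> u \<noteq> v \<Longrightarrow> (u, v) \<in> A \<or> (v, u) \<in> A"
    using assms by (auto simp: semicomplete_def digraph_def)
  obtain f :: "'a \<Rightarrow> nat" where f: "inj_on f V" using finite_imp_inj_to_nat_seg V(1) by metis
  let ?T = "{(u, v) \<in> A. (v, u) \<notin> A \<or> f u < f v}"
  have "tournament V ?T" unfolding tournament_def
  proof (intro conjI allI ballI impI)
    fix u v assume uv: "u \<in> V" "v \<in> V" "u \<noteq> v"
    then have "f u \<noteq> f v" using f by (auto simp: inj_on_def)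
    then show "(u, v) \<in> ?T \<or> (v, u) \<in> ?T" using V(4)[OF uv] by auto
  qed (use V in auto)
  then show ?thesis by (intro exI[of _ ?T]) auto
qed

text \<open>Double counting on the low vertices \<open>?B\<close>: arcs, reversed arcs and the
  diagonal cover \<open>?B \<times> ?B\<close>, and there are at most \<open>card ?B * L\<close>
  arcs. Applied to \<open>T\<inverse>\<close>, it bounds the vertices of low in-degree.\<close>

lemma tournament_card_low_out_degree:
  assumes T: "tournament V T" and M: "M \<subseteq> V"
  shows "card {v \<in> M. card (T `` {v} \<inter> M) \<le> L} \<le> 2 * L + 1"
proof -
  let ?B = "{v \<in> M. card (T `` {v} \<inter> M) \<le> L}"
  have "finite M" using T M finite_subset by (auto simp: tournament_def)
  then have fin: "finite M" "finite ?B" by auto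
  let ?E = "SIGMA v:?B. T `` {v} \<inter> ?B"
  have sub: "?B \<times> ?B \<subseteq> ?E \<union> ?E\<inverse> \<union> (\<lambda>v. (v, v)) ` ?B"
    using T M unfolding tournament_def by blast
  have fE: "finite ?E" by (rule finite_subset[of _ "?B \<times> ?B"]) (use fin in auto)
  have cE: "card ?E \<le> card ?B * L"
  proof -
    have "card ?E = (\<Sum>v\<in>?B. card (T `` {v} \<inter> ?B))" using fin by (subst card_SigmaI) auto
    also have "\<dots> \<le> (\<Sum>v\<in>?B. L)"
    proof (rule sum_mono)
      fix v assume "v \<in> ?B"
      moreover have "card (T `` {v} \<inter> ?B) \<le> card (T `` {v} \<inter> M)"
        using fin by (intro card_mono) auto
      ultimately show "card (T `` {v} \<inter> ?B) \<le> L" by simp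
    qed
    finally show ?thesis by simp
  qed
  have "card ?B * card ?B = card (?B \<times> ?B)"
    by (rule card_cartesian_product[symmetric])
  also have "\<dots> \<le> card (?E \<union> ?E\<inverse> \<union> (\<lambda>v. (v, v)) ` ?B)"
    using fE fin by (intro card_mono sub) auto
  also have "\<dots> \<le> card ?E + card (?E\<inverse>) + card ((\<lambda>v. (v, v)) ` ?B)"
    by (meson add_le_mono1 card_Un_le le_trans)
  also have "\<dots> \<le> card ?B * (2 * L + 1)"
  proof -
    have "card (?E\<inverse>) = card ?E" using card_inverse by blast
    moreover have "card ((\<lambda>v. (v, v)) ` ?B) = card ?B" by (intro card_image) (auto simp: inj_on_def)
    ultimately have "card ?E + card (?E\<inverse>) + card ((\<lambda>v. (v, v)) ` ?B) \<le> card ?B * L + card ?B * L + card ?B"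
      using cE by linarith
    then show ?thesis by (simp add: algebra_simps)
  qed
  finally have "card ?B * card ?B \<le> card ?B * (2 * L + 1)" .
  then show ?thesis by (cases "card ?B = 0") (simp_all only: mult_le_cancel1)
qed

text \<open>At least \<open>r\<close> out-neighbours of \<open>w\<close> are not out-neighbours of
  \<open>z\<close>. Since \<open>z\<close> has no smaller out-degree, at least \<open>r\<close>
  out-neighbours of \<open>z\<close> are not out-neighbours of \<open>w\<close>, and each of these
  dominates \<open>w\<close>.\<close>

lemma tournament_card_two_paths:
  assumes T: "tournament V T" and wz: "(w, z) \<in> T" and le: "card (T `` {w}) \<le> card (T `` {z})"
    and r: "r \<le> card (T\<inverse> `` {z} \<inter> T `` {w})"
  shows "r \<le> card {y. (z, y) \<in> T \<and> (y, w) \<in> T}"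
proof -
  note fin = tournament_finite_Image[OF T]
  have "T\<inverse> `` {z} \<inter> T `` {w} \<subseteq> T `` {w} - T `` {z}" using T by (auto simp: tournament_def)
  then have "r \<le> card (T `` {w} - T `` {z})" using r fin by (meson card_mono finite_Diff le_trans)
  also have "\<dots> \<le> card (T `` {z} - T `` {w})"
    using le fin by (simp add: card_Diff_subset_Int Int_commute)
  also have "\<dots> \<le> card {y. (z, y) \<in> T \<and> (y, w) \<in> T}"
  proof (rule card_mono)
    show "finite {y. (z, y) \<in> T \<and> (y, w) \<in> T}" by (rule finite_subset[OF _ fin(1)[of "{z}"]]) auto
    show "T `` {z} - T `` {w} \<subseteq> {y. (z, y) \<in> T \<and> (y, w) \<in> T}"
    proof
      fix y assume y: "y \<in> T `` {z} - T `` {w}"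
      then have "y \<noteq> w" "y \<in> V" "w \<in> V" using T wz by (auto simp: tournament_def)
      then have "(y, w) \<in> T" using T y unfolding tournament_def by blast
      then show "y \<in> {y. (z, y) \<in> T \<and> (y, w) \<in> T}" using y by auto
    qed
  qed
  finally show ?thesis .
qed

lemma exists_lowest_subset:
  fixes f :: "'a \<Rightarrow> nat"
  assumes "finite B" "n \<le> card B"
  shows "\<exists>W\<subseteq>B. card W = n \<and> (\<forall>w\<in>W. \<forall>v\<in>B - W. f w \<le> f v)"
  using assms(2)
proof (induction n)
  case 0
  then show ?case by (intro exI[of _ "{}"]) auto
next
  case (Suc n)
  then obtain W where W: "W \<subseteq> B" "card W = n" "\<forall>w\<in>W. \<forall>v\<in>B - W. f w \<le> f v" by auto
  have finW: "finite W" using W(1) assms(1) finite_subset by auto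
  then have "B - W \<noteq> {}" using W Suc.prems by (metis Diff_eq_empty_iff card_mono not_less_eq_eq)
  then obtain m where m: "m \<in> B - W" "\<forall>v\<in>B - W. f m \<le> f v"
    using ex_has_least_nat[of "\<lambda>v. v \<in> B - W" _ f] by blast
  then show ?case using W finW by (intro exI[of _ "insert m W"]) auto
qed

section \<open>Surviving the deletion of reserved vertices\<close>

lemma first_entry:
  assumes "p \<noteq> []" "hd p \<notin> N" "last p \<in> N"
  shows "\<exists>i. Suc i < length p \<and> p ! Suc i \<in> N \<and> (\<forall>j\<le>i. p ! j \<notin> N)"
proof -
  let ?Q = "\<lambda>i. i < length p \<and> p ! i \<in> N"
  have ex: "\<exists>i. ?Q i" using assms(1,3) by (intro exI[of _ "length p - 1"]) (simp add: last_conv_nth)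
  define u where "u = (LEAST i. ?Q i)"
  have u: "?Q u" using LeastI_ex[OF ex] by (simp add: u_def)
  have least: "\<not> ?Q j" if "j < u" for j using that not_less_Least u_def by metis
  have "u \<noteq> 0" using u assms(1,2) by (metis hd_conv_nth)
  then obtain i where "u = Suc i" using not0_implies_Suc by blast
  then show ?thesis using u least by (intro exI[of _ i]) auto
qed

text \<open>
  A set \<open>C\<close> of fewer than \<open>k\<close> vertices misses two of the \<open>k + 1\<close> paths of \<open>P\<close>, so if \<open>C \<union> R\<close> were a cut,
  these two would cross it in vertices of \<open>R\<close>, which \<open>cross\<close> forbids. The hypothesis \<open>low\<close> takes care
  of cuts that separate only few vertices.
\<close>

lemma linkage_after_deletion:
  fixes k :: nat
  assumes A: "semicomplete V A" and TA: "T \<subseteq> A" and T: "tournament V T"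
    and k: "k \<ge> 1" and X: "X \<subseteq> V" "card X \<le> k" and H: "H = V - X"
    and conn: "\<And>S a b. \<lbrakk>S \<subseteq> H; card S < k; a \<in> H - S; b \<in> H - S; a \<noteq> b\<rbrakk> \<Longrightarrow>
      \<exists>p. path_avoiding V A (S \<union> X) a b p"
    and P: "linkage (A \<inter> H \<times> H) W Z P" "card P = k + 1" and W: "W \<subseteq> H" "card W > 4 * k"
    and Z: "Z \<subseteq> H" "card Z = k + 1"
      "\<And>z v. z \<in> Z \<Longrightarrow> v \<in> H - Z \<Longrightarrow> card (T\<inverse> `` {z} \<inter> H) \<le> card (T\<inverse> `` {v} \<inter> H)"
    and R: "R \<subseteq> H" "card R \<le> 3 * k" "R \<inter> Z = {}"
    and low: "\<And>v. v \<in> V \<Longrightarrow> card (A\<inverse> `` {v}) \<le> 16 * k \<Longrightarrow> R \<inter> A\<inverse> `` {v} = {}"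
    and start: "\<And>p. p \<in> P \<Longrightarrow> p ! 0 \<notin> R"
    and spaced: "\<And>p s. p \<in> P \<Longrightarrow> Suc s < length p \<Longrightarrow> p ! Suc s \<in> R \<Longrightarrow> p ! s \<notin> R"
    and cross: "\<And>p q s t. \<lbrakk>p \<in> P; q \<in> P; p \<noteq> q; s < length p; t < length q; p ! s \<in> R; q ! t \<in> R\<rbrakk> \<Longrightarrow>
      \<not> crossing A p s q t"
    and Y: "Y \<subseteq> H - R" "card Y = k"
  shows "\<exists>P'. linkage (A \<inter> (H - R) \<times> (H - R)) (W - R) Y P' \<and> card P' = k"
proof (rule menger)
  have finV: "finite V" and AV: "A \<subseteq> V \<times> V"
    using A by (auto simp: semicomplete_def digraph_def)
  then have finH: "finite H" using H by simp
  show "finite (A \<inter> (H - R) \<times> (H - R))" using finH by simp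
  show "finite (W - R)" using finH W finite_subset by blast
  fix C assume C: "finite C" "separates (A \<inter> (H - R) \<times> (H - R)) (W - R) Y C"
  show "k \<le> card C"
  proof (rule ccontr)
    assume "\<not> k \<le> card C"
    define S where "S = C \<inter> (H - R)"
    have S: "S \<subseteq> H" "S \<inter> R = {}" "card S < k" "finite S"
      using \<open>\<not> k \<le> card C\<close> C(1) card_mono[of C S] by (auto simp: S_def)
    define G where "G = H - R - S"
    \<comment> \<open>\<open>N\<close> consists of the vertices that still reach \<open>Y\<close>
      inside \<open>G\<close>. No arc leads from its complement \<open>B\<close> to
      \<open>N\<close>, so \<open>T\<close> contains all arcs from \<open>N\<close> to
      \<open>B\<close>; the vertices of \<open>W\<close> in \<open>G\<close> belong to
      \<open>B\<close>.\<close>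
    define N where "N = {v \<in> G. \<exists>q. walk A q \<and> set q \<subseteq> G \<and> hd q = v \<and> last q \<in> Y}"
    define B where "B = G - N"
    have fins: "finite R" "finite N" "finite B" "finite W" "finite X" "finite Z"
      using finH finV R W X Z finite_subset by (auto simp: N_def B_def G_def)
    have noarc: "(b, n) \<notin> A" if bn: "b \<in> B" "n \<in> N" for b n
    proof
      assume e: "(b, n) \<in> A"
      obtain q where q: "walk A q" "set q \<subseteq> G" "hd q = n" "last q \<in> Y" using bn by (auto simp: N_def)
      moreover from q(1) have "q \<noteq> []" by (simp add: walk_def)
      ultimately have "walk A (b # q)" "last (b # q) \<in> Y" using e by (auto simp: walk_Cons)
      then have "b \<in> N" using bn(1) q(2) unfolding N_def B_def by (intro CollectI conjI exI[of _ "b # q"]) auto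
      then show False using bn(1) by (simp add: B_def)
    qed
    have arc: "(n, b) \<in> T" if "b \<in> B" "n \<in> N" for b n
    proof -
      have "b \<in> V" "n \<in> V" "b \<noteq> n" using that H by (auto simp: B_def N_def G_def)
      then show ?thesis using noarc[OF that] T TA unfolding tournament_def by blast
    qed
    have WB: "w \<in> B" if w: "w \<in> W" "w \<in> G" for w
    proof (rule ccontr)
      assume "w \<notin> B"
      then obtain q where q: "walk A q" "set q \<subseteq> G" "hd q = w" "last q \<in> Y"
        using w by (auto simp: B_def N_def)
      have "set q \<subseteq> H - R" using q(2) by (auto simp: G_def)
      then have "set q \<inter> C \<noteq> {}"
        using separates_walk[OF C(2) walk_restrict[OF q(1)]] q w by (auto simp: G_def)
      then show False using q(2) by (auto simp: G_def S_def)
    qed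
    \<comment> \<open>\<open>R\<close> and \<open>S\<close> have fewer than \<open>4 * k\<close>
      vertices together and cannot cover \<open>W\<close>.\<close>
    obtain w0 where w0: "w0 \<in> B"
    proof -
      have "card (R \<union> S) \<le> card R + card S" by (rule card_Un_le)
      then have "card (R \<union> S) < card W" using S(3) R(2) W(2) by linarith
      then obtain w where "w \<in> W" "w \<notin> R \<union> S"
        using fins S(4) by (metis card_mono finite_UnI not_le subsetI)
      then show ?thesis using that WB W(1) by (auto simp: G_def)
    qed
    obtain y0 where y0: "y0 \<in> N"
    proof -
      obtain y where "y \<in> Y" "y \<notin> S" using S Y(2) by (metis card_mono not_le subsetI)
      then have "y \<in> N" using Y(1) unfolding N_def
        by (intro CollectI conjI exI[of _ "[y]"]) (auto simp: G_def)
      then show ?thesis using that by blast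
    qed
    have cSR: "card (S \<union> R) \<le> 4 * k - 1"
      using card_Un_le[of S R] S(3) R(2) k by linarith
    show False
    proof (cases "card N < 11 * k")
      case True
      \<comment> \<open>Deleting only \<open>S\<close> and \<open>X\<close> leaves a path from
        \<open>B\<close> to \<open>N\<close>, which must enter \<open>N\<close> from
        \<open>R\<close>. The entered vertex has in-degree at most
        \<open>(11 * k - 1) + (4 * k - 1) + k\<close>, so \<open>low\<close> applies to it and
        forbids this.\<close>
      obtain p where p: "path_avoiding V A (S \<union> X) w0 y0 p"
        using conn[OF S(1,3), of w0 y0] w0 y0 H by (auto simp: B_def N_def G_def)
      then have pp: "dpath A p" "set p \<subseteq> V - (S \<union> X)" "hd p \<notin> N" "last p \<in> N" "p \<noteq> []"
        using w0 y0 by (auto simp: path_avoiding_def B_def dpath_def)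
      obtain i where i: "Suc i < length p" "p ! Suc i \<in> N" "p ! i \<notin> N"
        using first_entry[OF pp(5,3,4)] by blast
      let ?u = "p ! i" and ?v = "p ! Suc i"
      have e: "(?u, ?v) \<in> A" using pp(1) i by (auto simp: dpath_def)
      have "?u \<in> set p" using i by simp
      then have "?u \<in> H - S" using pp(2) H by blast
      then have "?u \<in> B \<or> ?u \<in> R" using i(3) by (auto simp: B_def G_def)
      then have uR: "?u \<in> R" using noarc e i(2) by blast
      have "A\<inverse> `` {?v} \<subseteq> N \<union> (S \<union> R) \<union> X"
      proof
        fix a assume "a \<in> A\<inverse> `` {?v}"
        then have "(a, ?v) \<in> A" by auto
        moreover from this have "a \<in> V" using AV by auto
        ultimately show "a \<in> N \<union> (S \<union> R) \<union> X" using noarc[OF _ i(2)] H by (auto simp: B_def G_def)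
      qed
      then have "card (A\<inverse> `` {?v}) \<le> card (N \<union> (S \<union> R) \<union> X)"
        using fins S(4) by (intro card_mono) auto
      also have "\<dots> \<le> card N + card (S \<union> R) + card X"
        by (meson add_le_mono1 card_Un_le le_trans)
      also have "\<dots> \<le> 16 * k" using True cSR X(2) by linarith
      finally have "R \<inter> A\<inverse> `` {?v} = {}" using low[of ?v] i(2) H by (auto simp: N_def G_def)
      then show False using uR e by auto
    next
      case False
      \<comment> \<open>\<open>N\<close> dominates \<open>B\<close>, and many vertices of the large set \<open>N\<close> have in-degree below \<open>card N\<close>;
        hence the low in-degree vertices \<open>Z\<close> avoid \<open>B\<close>, and every path of \<open>P\<close> must cross the cut.\<close>
      let ?n = "card N"
      have NV: "N \<subseteq> V" using H by (auto simp: N_def G_def)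
      have T': "tournament V (T\<inverse>)" using T by (rule tournament_converse)
      let ?lo = "{v \<in> N. card (T\<inverse> `` {v} \<inter> H) < ?n}"
      have lo: "card ?lo \<ge> k + 1"
      proof -
        \<comment> \<open>A vertex of \<open>N\<close> with at least \<open>5 * k\<close>
          out-neighbours in \<open>N\<close> has in-degree at most
          \<open>?n - 5 * k + (4 * k - 1)\<close> in \<open>H\<close>. At most
          \<open>10 * k - 1\<close> vertices of \<open>N\<close> fail this, which leaves
          \<open>k + 1\<close> out of \<open>11 * k\<close>.\<close>
        let ?hi = "{v \<in> N. card (T `` {v} \<inter> N) \<le> 5 * k - 1}"
        have c_hi: "card {v \<in> N. card (T `` {v} \<inter> N) \<le> 5 * k - 1} \<le> 2 * (5 * k - 1) + 1"
          by (rule tournament_card_low_out_degree[OF T NV])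
        have "N - ?hi \<subseteq> ?lo"
        proof
          fix v assume v: "v \<in> N - ?hi"
          have "T\<inverse> `` {v} \<inter> H \<subseteq> (N - T `` {v} \<inter> N) \<union> (S \<union> R)"
          proof
            fix a assume a: "a \<in> T\<inverse> `` {v} \<inter> H"
            then have "(a, v) \<in> T" "(v, a) \<notin> T" "a \<in> H" using T by (auto simp: tournament_def)
            then show "a \<in> (N - T `` {v} \<inter> N) \<union> (S \<union> R)"
              using noarc[of a v] v TA by (auto simp: B_def G_def)
          qed
          then have "card (T\<inverse> `` {v} \<inter> H) \<le> card ((N - T `` {v} \<inter> N) \<union> (S \<union> R))"
            using fins S(4) by (intro card_mono) auto
          also have "\<dots> \<le> card (N - T `` {v} \<inter> N) + card (S \<union> R)" by (rule card_Un_le)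
          also have "card (N - T `` {v} \<inter> N) = ?n - card (T `` {v} \<inter> N)"
            using fins by (intro card_Diff_subset) auto
          finally show "v \<in> ?lo" using v cSR k False by auto
        qed
        then have "card (N - ?hi) \<le> card ?lo" using fins by (intro card_mono) auto
        moreover have "card (N - ?hi) = ?n - card ?hi" using fins by (intro card_Diff_subset) auto
        ultimately show ?thesis using c_hi False k by linarith
      qed
      have ZB: "z \<notin> B" if z: "z \<in> Z" for z
      proof
        assume zB: "z \<in> B"
        have "N \<subseteq> T\<inverse> `` {z} \<inter> H" using arc[OF zB] by (auto simp: N_def G_def)
        then have zc: "?n \<le> card (T\<inverse> `` {z} \<inter> H)" using finH by (intro card_mono) auto
        \<comment> \<open>By the choice of \<open>Z\<close>, the at least \<open>k + 1\<close>
          vertices of smaller in-degree than \<open>z\<close> would all lie in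
          \<open>Z - {z}\<close>, which has only \<open>k\<close>.\<close>
        have "?lo \<subseteq> Z - {z}"
        proof
          fix v assume v: "v \<in> ?lo"
          then have "v \<in> H" "v \<noteq> z" using zB by (auto simp: N_def G_def B_def)
          then show "v \<in> Z - {z}" using Z(3)[OF z, of v] v zc by fastforce
        qed
        then have "card ?lo \<le> card (Z - {z})" using fins by (intro card_mono) auto
        then show False using lo z Z(2) fins by simp
      qed
      \<comment> \<open>A path off \<open>S\<close> runs from \<open>B\<close> to \<open>N\<close>
        and enters \<open>N\<close> from \<open>R\<close>. The vertex in \<open>R\<close> is not the
        first one by \<open>start\<close>, and its predecessor, outside \<open>R\<close> by
        \<open>spaced\<close>, lies in \<open>B\<close>.\<close>
      have transit: "\<exists>s>0. Suc s < length p \<and> p ! s \<in> R \<and> p ! (s + 1) \<in> N \<and> p ! (s - 1) \<in> B"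
        if p: "p \<in> P" "set p \<inter> S = {}" for p
      proof -
        have d: "dpath (A \<inter> H \<times> H) p" "hd p \<in> W" "last p \<in> Z" "p \<noteq> []"
          using P(1) p by (auto simp: linkage_def dpath_def)
        have inH: "p ! i \<in> H - S" if "i < length p" for i
        proof -
          have "p ! i \<in> H"
          proof (cases i)
            case 0
            then show ?thesis using d W(1) by (auto simp: hd_conv_nth)
          next
            case (Suc j)
            then show ?thesis using d(1) that by (auto simp: dpath_def)
          qed
          moreover have "p ! i \<in> set p" using that by simp
          ultimately show ?thesis using p(2) by blast
        qed
        have "hd p \<in> B"
          using WB[OF d(2)] start[OF p(1)] inH[of 0] d(4) by (auto simp: G_def hd_conv_nth)
        moreover have "last p \<in> N"
        proof -
          have "last p \<in> H - S" using inH[of "length p - 1"] d(4) by (simp add: last_conv_nth)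
          then show ?thesis using ZB[OF d(3)] R(3) d(3) by (auto simp: B_def G_def)
        qed
        ultimately obtain i where i: "Suc i < length p" "p ! Suc i \<in> N" "\<forall>j\<le>i. p ! j \<notin> N"
          using first_entry[of p N] d(4) by (auto simp: B_def)
        have e: "(p ! i, p ! Suc i) \<in> A" using d(1) i by (auto simp: dpath_def)
        have "p ! i \<in> R" using noarc[OF _ i(2)] e inH[of i] i by (auto simp: B_def G_def)
        moreover from this have i0: "i > 0" using start[OF p(1)] by (cases i) auto
        moreover have "p ! (i - 1) \<in> B"
        proof -
          have "p ! (i - 1) \<notin> R" using spaced[OF p(1), of "i - 1"] i0 i(1) \<open>p ! i \<in> R\<close> by auto
          then show ?thesis using inH[of "i - 1"] i by (auto simp: B_def G_def)
        qed
        ultimately show ?thesis using i by (intro exI[of _ i]) auto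
      qed
      have finP: "finite P" using P(1) by (simp add: linkage_def)
      let ?hit = "{p \<in> P. set p \<inter> S \<noteq> {}}"
      have "card ?hit \<le> card S"
      proof -
        have "\<forall>p\<in>?hit. \<exists>s. s \<in> set p \<inter> S" by blast
        from bchoice[OF this] obtain g where g: "\<forall>p\<in>?hit. g p \<in> set p \<inter> S" ..
        have "inj_on g ?hit"
        proof (rule inj_onI, rule ccontr)
          fix p q assume pq: "p \<in> ?hit" "q \<in> ?hit" "g p = g q" "p \<noteq> q"
          then have "g p \<in> set p" "g q \<in> set q" using g by blast+
          then have "g p \<in> set p \<inter> set q" using pq(3) by simp
          then show False using P(1) pq unfolding linkage_def by blast
        qed
        then show ?thesis using g S(4) by (intro card_inj_on_le[of g]) auto
      qed
      \<comment> \<open>Disjoint paths need different vertices of \<open>S\<close>, so at most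
        \<open>k - 1\<close> of the \<open>k + 1\<close> paths are hit.\<close>
      then have "card (P - ?hit) \<ge> 2"
        using P(2) S(3) finP by (subst card_Diff_subset) auto
      then have "\<not> card (P - ?hit) \<le> Suc 0" by simp
      then have "\<exists>p\<in>P - ?hit. \<exists>q\<in>P - ?hit. p \<noteq> q"
        unfolding card_le_Suc0_iff_eq[OF finite_Diff[OF finP]] by blast
      then obtain p q where pq: "p \<in> P - ?hit" "q \<in> P - ?hit" "p \<noteq> q" by blast
      obtain s where s: "s > 0" "Suc s < length p" "p ! s \<in> R" "p ! (s + 1) \<in> N" "p ! (s - 1) \<in> B"
        using transit[of p] pq by blast
      obtain t where t: "t > 0" "Suc t < length q" "q ! t \<in> R" "q ! (t + 1) \<in> N" "q ! (t - 1) \<in> B"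
        using transit[of q] pq by blast
      have "crossing A p s q t"
        using arc[OF t(5) s(4)] arc[OF s(5) t(4)] TA by (auto simp: crossing_def)
      then show False using cross[of p q s t] pq s t by auto
    qed
  qed
qed

subsection \<open>Linking the terminals\<close>

lemma mod_eq_less_imp_add_le:
  assumes "t mod m = t' mod m" "t < t'"
  shows "t + m \<le> (t' :: nat)"
  using assms by (metis add.commute mod_eq_dvd_iff_nat dvd_imp_le zero_less_diff less_imp_le_nat le_diff_conv2)

lemma exists_not_in:
  assumes "finite F" "card F < card S"
  shows "\<exists>s\<in>S. s \<notin> F"
  using assms card_mono[of F S] by (meson not_le subsetI)

text \<open>Every vertex but the first is the head of an arc inside \<open>G\<close>; the first one
  is in \<open>S\<close>.\<close>

lemma linkage_set_subset:
  assumes "linkage (A \<inter> G \<times> G) S T P" "S \<subseteq> G" "p \<in> P"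
  shows "set p \<subseteq> G"
proof
  fix v assume "v \<in> set p"
  then obtain i where i: "i < length p" "p ! i = v" by (auto simp: in_set_conv_nth)
  have d: "dpath (A \<inter> G \<times> G) p" "hd p \<in> S" using assms by (auto simp: linkage_def)
  show "v \<in> G"
  proof (cases i)
    case 0
    then show ?thesis using i d assms(2) by (cases p) auto
  next
    case (Suc j)
    then show ?thesis using i d(1) by (auto simp: dpath_def)
  qed
qed

lemma card_UN_take_le:
  assumes "finite P"
  shows "card (\<Union>p\<in>P. set (take n p)) \<le> n * card P"
proof -
  have "card (\<Union>p\<in>P. set (take n p)) \<le> (\<Sum>p\<in>P. card (set (take n p)))"
    using assms by (rule card_UN_le)
  also have "\<dots> \<le> (\<Sum>p\<in>P. n)"
  proof (rule sum_mono)
    fix p :: "'a list"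
    show "card (set (take n p)) \<le> n" using card_length[of "take n p"] by simp
  qed
  finally show ?thesis by (simp add: mult.commute)
qed

lemma nth_mem_take: "s < n \<Longrightarrow> s < length p \<Longrightarrow> p ! s \<in> set (take n p)"
  by (auto simp: in_set_conv_nth intro!: exI[of _ s])

text \<open>The auxiliary sets for fixed terminals. \<open>F\<close> contains all in-neighbours of
  vertices of in-degree at most \<open>16 * k\<close>; reserved vertices avoid it, which yields the
  hypothesis \<open>low\<close> of \<open>linkage_after_deletion\<close>.\<close>

locale linking =
  fixes k :: nat and V :: "'a set" and A T :: "('a \<times> 'a) set" and x y :: "nat \<Rightarrow> 'a"
    and X Y F Z W :: "'a set"
  assumes k1: "k \<ge> 1" and A: "semicomplete V A" and TA: "T \<subseteq> A" and T: "tournament V T"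
    and deg: "\<And>v. v \<in> V \<Longrightarrow> 10 ^ 7 * k ^ 4 \<le> card (A `` {v})"
    and X: "X = x ` {..<k}" "inj_on x {..<k}" "X \<subseteq> V"
    and Y: "Y = y ` {..<k}" "inj_on y {..<k}" "Y \<subseteq> V" and XY: "X \<inter> Y = {}"
    and conn: "\<And>S a b. \<lbrakk>S \<subseteq> V - X; card S \<le> k; a \<in> V - X - S; b \<in> V - X - S; a \<noteq> b\<rbrakk> \<Longrightarrow>
      \<exists>p. path_avoiding V A (S \<union> X) a b p"
    and F: "finite F" "card F \<le> 561 * k ^ 2"
      "\<And>v. v \<in> V \<Longrightarrow> card (A\<inverse> `` {v}) \<le> 16 * k \<Longrightarrow> A\<inverse> `` {v} \<subseteq> F"
    and Z: "Z \<subseteq> V - X" "card Z = k + 1"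
      "\<And>z v. z \<in> Z \<Longrightarrow> v \<in> V - X - Z \<Longrightarrow>
         card (T\<inverse> `` {z} \<inter> (V - X)) \<le> card (T\<inverse> `` {v} \<inter> (V - X))"
    and W: "W \<subseteq> V - (X \<union> Y \<union> F)" "card W = 100 * k"
      "\<And>w v. w \<in> W \<Longrightarrow> v \<in> V - (X \<union> Y \<union> F) - W \<Longrightarrow> card (T `` {w}) \<le> card (T `` {v})"
begin

lemma finV: "finite V" and AV: "A \<subseteq> V \<times> V"
  and total: "u \<in> V \<Longrightarrow> v \<in> V \<Longrightarrow> u \<noteq> v \<Longrightarrow> (u, v) \<in> A \<or> (v, u) \<in> A"
  using A by (auto simp: semicomplete_def digraph_def)

lemma finite_sets: "finite X" "finite Y" "finite Z" "finite W" "finite F" "finite A"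
  using finV X(3) Y(3) Z(1) W(1) F(1) AV finite_subset[of Z V] finite_subset[of W V]
  by (auto intro: finite_subset)

lemma card_X: "card X = k" and card_Y: "card Y = k"
  using X Y by (simp_all add: card_image)

lemma k_powers: "k \<le> k ^ 2" "k ^ 2 \<le> k ^ 3" "k ^ 3 \<le> k ^ 4"
  using k1 power_increasing[of 1 2 k] power_increasing[of 2 3 k] power_increasing[of 3 4 k] by simp_all

text \<open>A route ending in \<open>W0\<close> can be continued to a free vertex of
  \<open>W\<close>: \<open>linked\<close> excludes at most \<open>7 * k\<close> of the more than
  \<open>10 * k\<close> out-neighbours.\<close>

definition W0 :: "'a set" where
  "W0 = {w \<in> W. card (T `` {w} \<inter> W) > 10 * k}"

lemma card_W0: "card W0 \<ge> 79 * k"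
proof -
  let ?B = "{w \<in> W. card (T `` {w} \<inter> W) \<le> 10 * k}"
  have "card ?B \<le> 2 * (10 * k) + 1"
    using W(1) by (intro tournament_card_low_out_degree[OF T]) auto
  moreover have "W0 = W - ?B" by (auto simp: W0_def)
  moreover from this have "card W0 = card W - card ?B"
    using finite_sets by (simp add: card_Diff_subset)
  ultimately show ?thesis using W(2) k1 by linarith
qed

text \<open>
  \<open>W\<close> has lowest out-degree, so every vertex outside \<open>W\<close> and \<open>exceptional w\<close> reaches \<open>w\<close> by an arc or by
  many paths of length two.
\<close>

definition exceptional :: "'a \<Rightarrow> 'a set" where
  "exceptional w = {z \<in> T `` {w}. card (T\<inverse> `` {z} \<inter> T `` {w}) \<le> 600 * k ^ 2}"

lemma exceptional: "finite (exceptional w)" "card (exceptional w) \<le> 1201 * k ^ 2"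
proof -
  show "finite (exceptional w)"
    by (rule finite_subset[OF _ tournament_finite_Image(1)[OF T, of "{w}"]]) (auto simp: exceptional_def)
  have "card (exceptional w) \<le> 2 * (600 * k ^ 2) + 1"
    unfolding exceptional_def using T
    by (intro tournament_card_low_out_degree[OF tournament_converse[OF T]]) (auto simp: tournament_def)
  then show "card (exceptional w) \<le> 1201 * k ^ 2" using k_powers(1) k1 by linarith
qed

text \<open>If \<open>u\<close> does not dominate \<open>w\<close>, there are more than
  \<open>600 * k ^ 2\<close> two-step paths from \<open>u\<close> to \<open>w\<close>.
  \<open>D\<close> and the first three vertices of the paths of \<open>P\<close> block at most
  \<open>600 * k ^ 2\<close> of them, and a middle vertex further along a path would give a shortcut
  from the free source \<open>v\<close> through \<open>u\<close>.\<close>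

lemma connect:
  assumes P: "min_linkage (A \<inter> G \<times> G) W' Z' P" and G: "W' \<subseteq> G" "G \<subseteq> V"
    and v: "v \<in> W'" "v \<notin> (\<Union>p\<in>P. set p)"
    and u: "u \<in> G" "u \<notin> (\<Union>p\<in>P. set p)" "u \<notin> X \<union> Y \<union> F \<union> W \<union> exceptional w" "v \<noteq> u"
    and w: "w \<in> W" and e: "(v, u) \<in> A \<or> (u, w) \<in> A"
    and D: "finite D" "card D + 3 * card P \<le> 600 * k ^ 2"
  shows "\<exists>l. length l \<le> 1 \<and> walk A (u # l @ [w]) \<and> set l \<inter> (D \<union> (\<Union>p\<in>P. set p)) = {} \<and> set l \<subseteq> V"
proof (cases "(u, w) \<in> A")
  case True
  then show ?thesis by (intro exI[of _ "[]"]) (auto simp: walk_Cons)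
next
  case False
  have vu: "(v, u) \<in> A" using e False by blast
  have uV: "u \<in> V" "w \<in> V" "u \<noteq> w" using u w G W by auto
  then have wu: "(w, u) \<in> T" using T TA False unfolding tournament_def by blast
  have "card (T `` {w}) \<le> card (T `` {u})" using W(3)[OF w, of u] u uV by auto
  moreover have "600 * k ^ 2 + 1 \<le> card (T\<inverse> `` {u} \<inter> T `` {w})"
    using u(3) wu by (auto simp: exceptional_def)
  ultimately have many: "600 * k ^ 2 + 1 \<le> card {z. (u, z) \<in> T \<and> (z, w) \<in> T}"
    by (rule tournament_card_two_paths[OF T wu])
  have finP: "finite P" using P by (simp add: min_linkage_def linkage_def)
  let ?D = "D \<union> (\<Union>p\<in>P. set (take 3 p))"
  have "card ?D \<le> card D + card (\<Union>p\<in>P. set (take 3 p))" by (rule card_Un_le)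
  then have "card ?D < card {z. (u, z) \<in> T \<and> (z, w) \<in> T}"
    using card_UN_take_le[OF finP, of 3] D(2) many by linarith
  then obtain z where z: "(u, z) \<in> T" "(z, w) \<in> T" "z \<notin> ?D"
    using exists_not_in[of ?D] D(1) finP by auto
  have L: "linkage (A \<inter> G \<times> G) W' Z' P" using P by (simp add: min_linkage_def)
  have "z \<notin> (\<Union>p\<in>P. set p)"
  proof
    assume "z \<in> (\<Union>p\<in>P. set p)"
    then obtain p s where ps: "p \<in> P" "s < length p" "z = p ! s" by (auto simp: in_set_conv_nth)
    then have "z \<in> G" using linkage_set_subset[OF L G(1)] nth_mem by blast
    then have "s \<le> 2"
      using min_linkage_arc2_index[OF P ps(1,2) v u(2,4)] vu z ps u(1) v(1) G(1) TA by auto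
    then have "z \<in> set (take 3 p)" using ps nth_mem_take[of s 3 p] by auto
    then show False using z(3) ps(1) by auto
  qed
  then show ?thesis using z TA AV by (intro exI[of _ "[z]"]) (auto simp: walk_Cons)
qed

section \<open>The paths to \<open>Z\<close> and the reserved first steps\<close>

text \<open>A separator of at most \<open>k\<close> vertices misses some vertex of \<open>W\<close>
  and some vertex of \<open>Z\<close>, and even after deleting \<open>X\<close> as well these two
  are still connected.\<close>

lemma Z_linkage: "\<exists>P. min_linkage (A \<inter> (V - X) \<times> (V - X)) W Z P \<and> card P = k + 1"
proof -
  let ?H = "V - X"
  have "\<exists>P. linkage (A \<inter> ?H \<times> ?H) W Z P \<and> card P = k + 1"
  proof (rule menger)
    show "finite (A \<inter> ?H \<times> ?H)" "finite W" using finite_sets by auto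
    fix C assume C: "finite C" "separates (A \<inter> ?H \<times> ?H) W Z C"
    show "k + 1 \<le> card C"
    proof (rule ccontr)
      assume c: "\<not> k + 1 \<le> card C"
      then have "card C < card W" "card C < card Z" using W(2) Z(2) k1 by linarith+
      then obtain a b where ab: "a \<in> W" "a \<notin> C" "b \<in> Z" "b \<notin> C"
        using exists_not_in[OF C(1)] by meson
      let ?S = "C \<inter> ?H"
      have "card ?S \<le> k" using card_mono[OF C(1), of ?S] c by auto
      then have "\<exists>p. path_avoiding V A (?S \<union> X) a b p"
      proof (cases "a = b")
        \<comment> \<open>\<open>W\<close> and \<open>Z\<close> may meet; \<open>conn\<close> speaks
          of distinct vertices only.\<close>
        case True
        then show ?thesis using ab W(1)
          by (intro exI[of _ "[a]"]) (auto simp: path_avoiding_def dpath_iff_walk)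
      next
        case False
        then show ?thesis using conn[of ?S a b] \<open>card ?S \<le> k\<close> ab W(1) Z(1) by auto
      qed
      then obtain p where p: "path_avoiding V A (?S \<union> X) a b p" ..
      then have "walk (A \<inter> ?H \<times> ?H) p"
        by (intro walk_restrict) (auto simp: path_avoiding_def dpath_iff_walk)
      from separates_walk[OF C(2) this] show False
        using p ab by (auto simp: path_avoiding_def)
    qed
  qed
  then show ?thesis using min_linkage_exists by metis
qed

text \<open>Otherwise the \<open>4 * (k + 1) \<le> 8 * k\<close> pairs of a path and a residue would
  hold at most \<open>2 * k * k\<close> positions each, \<open>16 * k ^ 3\<close> in all. Within one
  residue class, distinct positions are at least 4 apart, as the exchange of tails requires.\<close>

lemma crowded_positions:
  assumes P: "finite P" "card P = k + 1" and C: "C \<subseteq> (\<Union>p\<in>P. set p)" and c: "16 * k ^ 3 < card C"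
  shows "\<exists>p\<in>P. \<exists>c. card {s. s < length p \<and> p ! s \<in> C \<and> s mod 4 = c} \<ge> 2 * k * k + 1"
proof (rule ccontr)
  assume n: "\<not> ?thesis"
  let ?S = "\<lambda>p c. {s. s < length p \<and> p ! s \<in> C \<and> s mod 4 = c}"
  have sm: "card ((!) p ` ?S p c) \<le> 2 * k * k" if "p \<in> P" for p c
  proof -
    have "card ((!) p ` ?S p c) \<le> card (?S p c)" by (intro card_image_le) auto
    also have "\<dots> \<le> 2 * k * k" using n that by (metis Suc_eq_plus1 not_less_eq_eq)
    finally show ?thesis .
  qed
  let ?I = "P \<times> {..<4::nat}"
  let ?U = "\<Union>pc\<in>?I. (!) (fst pc) ` ?S (fst pc) (snd pc)"
  have "C \<subseteq> ?U"
  proof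
    fix v assume v: "v \<in> C"
    with C obtain p where "p \<in> P" "v \<in> set p" by blast
    then obtain s where p: "p \<in> P" "s < length p" "p ! s = v" by (auto simp: in_set_conv_nth)
    then have "s \<in> ?S p (s mod 4)" using v by simp
    then show "v \<in> ?U" using p by (intro UN_I[of "(p, s mod 4)"]) auto
  qed
  then have "card C \<le> card ?U" using P by (intro card_mono) auto
  also have "\<dots> \<le> (\<Sum>pc\<in>?I. card ((!) (fst pc) ` ?S (fst pc) (snd pc)))"
    using P by (intro card_UN_le) auto
  also have "\<dots> \<le> (\<Sum>pc\<in>?I. 2 * k * k)" using sm by (intro sum_mono) auto
  also have "\<dots> = (k + 1) * 4 * (2 * k * k)" using P by (simp add: card_cartesian_product)
  also have "\<dots> \<le> (2 * k) * 4 * (2 * k * k)" using k1 by (intro mult_le_mono) auto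
  also have "\<dots> = 16 * k ^ 3" by (simp add: power3_eq_cube)
  finally show False using c by simp
qed

text \<open>The huge out-degree puts more than \<open>16 * k ^ 3\<close> out-neighbours of
  \<open>x i\<close> on the paths even after the exclusions. Omitting \<open>Y\<close>,
  \<open>F\<close> and \<open>Z\<close> prepares \<open>linkage_after_deletion\<close>; omitting the
  first two positions prevents arcs from free vertices of \<open>W\<close> to the candidate.\<close>

lemma bad_positions:
  assumes P: "min_linkage (A \<inter> (V - X) \<times> (V - X)) W Z P" "card P = k + 1"
    and i: "i < k" "card (A `` {x i} - (\<Union>p\<in>P. set p)) < 2000 * k ^ 2"
  shows "\<exists>p\<in>P. \<exists>c S. finite S \<and> card S \<ge> 2 * k * k + 1 \<and>
    (\<forall>s\<in>S. 2 \<le> s \<and> s < length p \<and> s mod 4 = c \<and> (x i, p ! s) \<in> A \<and> p ! s \<notin> Y \<union> F \<union> Z)"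
proof -
  let ?U = "\<Union>p\<in>P. set p"
  have finP: "finite P" using P by (simp add: min_linkage_def linkage_def)
  let ?C = "A `` {x i} \<inter> ?U - (Y \<union> F \<union> Z \<union> (\<Union>p\<in>P. set (take 2 p)))"
  have fA: "finite (A `` {x i})" using finite_sets by (simp add: finite_Image)
  have "x i \<in> V" using X i by auto
  have "A `` {x i} \<subseteq> ?C \<union> (A `` {x i} - ?U) \<union> Y \<union> F \<union> Z \<union> (\<Union>p\<in>P. set (take 2 p))" by auto
  then have "card (A `` {x i}) \<le> card (?C \<union> (A `` {x i} - ?U) \<union> Y \<union> F \<union> Z \<union> (\<Union>p\<in>P. set (take 2 p)))"
    using fA finite_sets finP by (intro card_mono) auto
  also have "\<dots> \<le> card ?C + card (A `` {x i} - ?U) + card Y + card F + card Z + card (\<Union>p\<in>P. set (take 2 p))"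
    by (meson add_le_mono1 card_Un_le le_trans)
  also have "\<dots> \<le> card ?C + 2000 * k ^ 2 + k + 561 * k ^ 2 + (k + 1) + 2 * (k + 1)"
    using i(2) card_Y F(2) Z(2) card_UN_take_le[OF finP, of 2] P(2)
    by (intro add_mono) simp_all
  finally have "10 ^ 7 * k ^ 4 \<le> card ?C + 2000 * k ^ 2 + k + 561 * k ^ 2 + (k + 1) + 2 * (k + 1)"
    using deg[OF \<open>x i \<in> V\<close>] by linarith
  moreover define n where "n = card ?C"
  ultimately have "10000000 * k ^ 4 \<le> n + 2561 * k ^ 2 + 4 * k + 3"
    by simp
  then have "16 * k ^ 3 < n" using k_powers k1 by linarith
  then have "16 * k ^ 3 < card ?C" by (simp only: n_def)
  then obtain p c where p: "p \<in> P"
    "card {s. s < length p \<and> p ! s \<in> ?C \<and> s mod 4 = c} \<ge> 2 * k * k + 1"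
    using crowded_positions[OF finP P(2), of ?C] by blast
  have "2 \<le> s" if "s < length p" "p ! s \<in> ?C" for s
    using nth_mem_take[of s 2 p] that p(1) by (meson DiffD2 UN_I UnI2 not_le)
  then show ?thesis using p
    by (intro bexI[of _ p] exI[of _ c] exI[of _ "{s. s < length p \<and> p ! s \<in> ?C \<and> s mod 4 = c}"]) auto
qed

text \<open>\<open>conflict_free_choice\<close> is applied to the candidates of
  \<open>bad_positions\<close>, to obtain the hypotheses \<open>spaced\<close> and
  \<open>cross\<close> of \<open>linkage_after_deletion\<close>.\<close>

lemma bad_selection:
  assumes P: "min_linkage (A \<inter> (V - X) \<times> (V - X)) W Z P" "card P = k + 1"
    and I: "I = {i. i < k \<and> card (A `` {x i} - (\<Union>p\<in>P. set p)) < 2000 * k ^ 2}"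
  shows "\<exists>\<pi> \<sigma>. (\<forall>i\<in>I. \<pi> i \<in> P \<and> 2 \<le> \<sigma> i \<and> \<sigma> i < length (\<pi> i) \<and> (x i, \<pi> i ! \<sigma> i) \<in> A \<and>
      \<pi> i ! \<sigma> i \<notin> Y \<union> F \<union> Z) \<and>
    (\<forall>i\<in>I. \<forall>j\<in>I. i \<noteq> j \<longrightarrow> \<pi> i = \<pi> j \<longrightarrow> \<not> (\<sigma> i \<le> \<sigma> j + 1 \<and> \<sigma> j \<le> \<sigma> i + 1)) \<and>
    (\<forall>i\<in>I. \<forall>j\<in>I. \<pi> i \<noteq> \<pi> j \<longrightarrow> \<not> crossing A (\<pi> i) (\<sigma> i) (\<pi> j) (\<sigma> j))"
proof -
  let ?H = "V - X"
  have L: "linkage (A \<inter> ?H \<times> ?H) W Z P" using P by (simp add: min_linkage_def)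
  have WH: "W \<subseteq> ?H" using W by auto
  have inH: "p ! s \<in> ?H" if "p \<in> P" "s < length p" for p s
    using linkage_set_subset[OF L WH] that nth_mem by blast
  define G where "G i p c S \<longleftrightarrow> p \<in> P \<and> finite S \<and> card S \<ge> 2 * k * k + 1 \<and>
    (\<forall>s\<in>S. 2 \<le> s \<and> s < length p \<and> s mod 4 = c \<and> (x i, p ! s) \<in> A \<and> p ! s \<notin> Y \<union> F \<union> Z)"
    for i p c S
  have "\<forall>i\<in>I. \<exists>p c S. G i p c S"
    using bad_positions[OF P] I unfolding G_def by blast
  then obtain \<pi> c S where G: "\<And>i. i \<in> I \<Longrightarrow> G i (\<pi> i) (c i) (S i)" by metis
  have S: "\<pi> i \<in> P \<and> finite (S i) \<and> card (S i) \<ge> 2 * k * k + 1" if "i \<in> I" for i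
    using G[OF that] by (simp add: G_def)
  have S': "2 \<le> s \<and> s < length (\<pi> i) \<and> s mod 4 = c i \<and> (x i, \<pi> i ! s) \<in> A \<and>
      \<pi> i ! s \<notin> Y \<union> F \<union> Z" if "i \<in> I" "s \<in> S i" for i s
    using G[OF that(1)] that(2) by (simp add: G_def)
  \<comment> \<open>On one path, a conflict means distance at most one, so each position has at most
    one partner in a residue class modulo 4. On different paths,
    \<open>min_linkage_no_double_crossing\<close> excludes the staircase pattern, as distinct
    positions in one class differ by at least 4.\<close>
  let ?Q = "\<lambda>i s j t. if \<pi> i = \<pi> j then s \<le> t + 1 \<and> t \<le> s + 1 else crossing A (\<pi> i) s (\<pi> j) t"
  have I': "finite I" "card I \<le> k" using I card_mono[of "{..<k}" I] by auto
  have "\<exists>\<sigma>. \<forall>i\<in>I. \<sigma> i \<in> S i \<and> (\<forall>j\<in>I. i \<noteq> j \<longrightarrow> \<not> ?Q i (\<sigma> i) j (\<sigma> j))"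
  proof (rule conflict_free_choice[OF I'])
    fix i assume "i \<in> I"
    moreover have "2 * k * card I \<le> 2 * k * k" using I'(2) by simp
    ultimately show "finite (S i) \<and> card (S i) \<ge> 2 * k * card I + 1" using S[of i] by linarith
  next
    fix i j B D assume ij: "i \<in> I" "j \<in> I" "i \<noteq> j" "B \<subseteq> S i" "D \<subseteq> S j"
    then have fin: "finite B" "finite D" using S finite_subset by metis+
    show "card {(s, t). s \<in> B \<and> t \<in> D \<and> ?Q i s j t} \<le> card B + card D"
    proof (cases "\<pi> i = \<pi> j")
      case True
      have "card {(s, t). s \<in> B \<and> t \<in> D \<and> (s \<le> t + 1 \<and> t \<le> s + 1)} \<le> card B"
      proof (rule spaced_card_le[OF fin])
        fix s t t' assume t: "t \<in> D" "t' \<in> D" "s \<le> t + 1 \<and> t \<le> s + 1" "s \<le> t' + 1 \<and> t' \<le> s + 1"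
        then have "t mod 4 = c j" "t' mod 4 = c j" using S'[OF ij(2)] ij(5) by blast+
        then have "t mod 4 = t' mod 4" by simp
        then show "t = t'"
          using t(3,4) mod_eq_less_imp_add_le[of t 4 t'] mod_eq_less_imp_add_le[of t' 4 t] by linarith
      qed
      then show ?thesis using True by simp
    next
      case False
      have "card {(s, t). s \<in> B \<and> t \<in> D \<and> crossing A (\<pi> i) s (\<pi> j) t} \<le> card B + card D"
      proof (rule staircase_card_le[OF fin])
        fix s1 s2 t1 t2
        assume a: "s1 \<in> B" "s2 \<in> B" "t1 \<in> D" "t2 \<in> D" "s1 < s2" "t1 < t2"
          "crossing A (\<pi> i) s2 (\<pi> j) t1" "crossing A (\<pi> i) s1 (\<pi> j) t2"
        have p: "\<pi> i \<in> P" "\<pi> j \<in> P" using S ij by auto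
        have "s1 mod 4 = c i" "s2 mod 4 = c i" "t1 mod 4 = c j" "t2 mod 4 = c j"
          "s2 < length (\<pi> i)" "t2 < length (\<pi> j)"
          using S'[OF ij(1)] S'[OF ij(2)] a(1-4) ij(4,5) by blast+
        then have s: "s1 mod 4 = s2 mod 4" "s2 < length (\<pi> i)"
          and t: "t1 mod 4 = t2 mod 4" "t2 < length (\<pi> j)" by simp_all
        have s4: "s1 + 4 \<le> s2" using s(1) a(5) by (rule mod_eq_less_imp_add_le)
        have t4: "t1 + 4 \<le> t2" using t(1) a(6) by (rule mod_eq_less_imp_add_le)
        show False
        proof (rule min_linkage_no_double_crossing[OF P(1) p False s4 s(2) t4 t(2)])
          show "(\<pi> i ! (s1 + 1), \<pi> j ! (t2 - 1)) \<in> A \<inter> ?H \<times> ?H"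
            using a(8) inH[OF p(1), of "s1 + 1"] inH[OF p(2), of "t2 - 1"] s4 t4 s t
            by (auto simp: crossing_def)
          show "(\<pi> j ! (t1 + 1), \<pi> i ! (s2 - 1)) \<in> A \<inter> ?H \<times> ?H"
            using a(7) inH[OF p(1), of "s2 - 1"] inH[OF p(2), of "t1 + 1"] s4 t4 s t
            by (auto simp: crossing_def)
        qed
      qed
      then show ?thesis using False by simp
    qed
  next
    fix i s j t assume "?Q i s j t"
    then show "?Q j t i s" by (auto simp: crossing_def split: if_splits)
  qed
  then obtain \<sigma> where \<sigma>: "\<And>i. i \<in> I \<Longrightarrow> \<sigma> i \<in> S i"
    "\<And>i j. i \<in> I \<Longrightarrow> j \<in> I \<Longrightarrow> i \<noteq> j \<Longrightarrow> \<not> ?Q i (\<sigma> i) j (\<sigma> j)" by blast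
  show ?thesis
  proof (intro exI[of _ \<pi>] exI[of _ \<sigma>] conjI ballI impI)
    fix i assume i: "i \<in> I"
    show "\<pi> i \<in> P" using S[OF i] by simp
    show "2 \<le> \<sigma> i" "\<sigma> i < length (\<pi> i)" "(x i, \<pi> i ! \<sigma> i) \<in> A" "\<pi> i ! \<sigma> i \<notin> Y \<union> F \<union> Z"
      using S'[OF i \<sigma>(1)[OF i]] by auto
  next
    fix i j assume ij: "i \<in> I" "j \<in> I" "i \<noteq> j" "\<pi> i = \<pi> j"
    show "\<not> (\<sigma> i \<le> \<sigma> j + 1 \<and> \<sigma> j \<le> \<sigma> i + 1)" using \<sigma>(2)[OF ij(1-3)] ij(4) by simp
  next
    fix i j assume ij: "i \<in> I" "j \<in> I" "\<pi> i \<noteq> \<pi> j"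
    then have "i \<noteq> j" by auto
    then show "\<not> crossing A (\<pi> i) (\<sigma> i) (\<pi> j) (\<sigma> j)" using \<sigma>(2)[OF ij(1,2)] ij(3) by simp
  qed
qed

text \<open>For \<open>i \<in> I\<close> only a free vertex of \<open>W0\<close> is set aside, as
  the first step of \<open>x i\<close> goes to the vertex selected on a path. The other sources get
  a complete route to \<open>W0\<close> off the paths.\<close>

lemma reservation_lists:
  assumes P: "min_linkage (A \<inter> (V - X) \<times> (V - X)) W Z P" "card P = k + 1"
    and I: "I = {i. i < k \<and> card (A `` {x i} - (\<Union>p\<in>P. set p)) < 2000 * k ^ 2}"
  shows "\<exists>l. (\<forall>i<k. length (l i) \<le> 3 \<and> l i \<noteq> [] \<and> last (l i) \<in> W0 \<and>
      set (l i) \<subseteq> V - X - Y - F - (\<Union>p\<in>P. set p) \<and>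
      (if i \<in> I then length (l i) = 1 else walk A (x i # l i))) \<and>
    (\<forall>i<k. \<forall>j<k. i \<noteq> j \<longrightarrow> set (l i) \<inter> set (l j) = {})"
proof -
  let ?H = "V - X" and ?U = "\<Union>p\<in>P. set p"
  have L: "linkage (A \<inter> ?H \<times> ?H) W Z P" and finP: "finite P"
    using P by (auto simp: min_linkage_def linkage_def)
  have WH: "W \<subseteq> ?H" using W by auto
  have WU: "card (W \<inter> ?U) \<le> k + 1"
  proof -
    \<comment> \<open>By minimality a path meets \<open>W\<close> only in its first vertex.\<close>
    have "W \<inter> ?U \<subseteq> hd ` P"
    proof
      fix v assume "v \<in> W \<inter> ?U"
      then obtain p s where p: "p \<in> P" "s < length p" "p ! s = v" "v \<in> W"
        by (auto simp: in_set_conv_nth)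
      then have "s = 0" using min_linkage_source_index[OF P(1)] by auto
      then have "v = hd p" using p by (cases p) auto
      then show "v \<in> hd ` P" using p(1) by blast
    qed
    then show ?thesis using card_mono[of "hd ` P" "W \<inter> ?U"] card_image_le[OF finP, of hd] finP P(2)
      by auto
  qed
  define Q where "Q i l \<longleftrightarrow> l \<noteq> [] \<and> last l \<in> W0 \<and> set l \<subseteq> V - X - Y - F - ?U \<and>
      (if i \<in> I then length l = 1 else walk A (x i # l))" for i l
  have "\<exists>l. (\<forall>i\<in>{..<k}. length (l i) \<le> 3 \<and> Q i (l i)) \<and>
      (\<forall>i\<in>{..<k}. \<forall>j\<in>{..<k}. i \<noteq> j \<longrightarrow> set (l i) \<inter> set (l j) = {})"
  proof (rule greedy_disjoint_lists)
    fix i and B :: "'a set" assume i: "i \<in> {..<k}" and B: "finite B" "card B \<le> 3 * card {..<k}"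
    have "card (B \<union> (W \<inter> ?U)) \<le> card B + card (W \<inter> ?U)" by (rule card_Un_le)
    then have "card (B \<union> (W \<inter> ?U)) < card W0" using card_W0 WU B(2) k1 by simp
    then obtain w where w0: "w \<in> W0" "w \<notin> B \<union> (W \<inter> ?U)"
      using exists_not_in[of "B \<union> (W \<inter> ?U)" W0] B(1) finite_sets by auto
    then have w: "w \<in> W" "w \<notin> B" "w \<notin> ?U" by (auto simp: W0_def)
    show "\<exists>l. length l \<le> 3 \<and> set l \<inter> B = {} \<and> Q i l"
    proof (cases "i \<in> I")
      case True
      then show ?thesis using w0 w W(1) by (intro exI[of _ "[w]"]) (auto simp: Q_def)
    next
      case False
      then have big: "2000 * k ^ 2 \<le> card (A `` {x i} - ?U)" using I i by auto
      \<comment> \<open>Fewer than \<open>2000 * k ^ 2\<close> vertices are excluded, so some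
        out-neighbour \<open>z\<close> of \<open>x i\<close> off the paths remains. In
        \<open>connect\<close> the vertex \<open>w\<close> then is both the free source and the
        target.\<close>
      let ?D = "X \<union> Y \<union> F \<union> W \<union> B \<union> exceptional w"
      have "card ?D \<le> card X + card Y + card F + card W + card B + card (exceptional w)"
        by (meson add_le_mono1 card_Un_le le_trans)
      also have "\<dots> \<le> k + k + 561 * k ^ 2 + 100 * k + 3 * k + 1201 * k ^ 2"
        using card_X card_Y F(2) W(2) B(2) exceptional(2)[of w] by simp
      also have "\<dots> = 105 * k + 1762 * k ^ 2" by simp
      also have "\<dots> < 2000 * k ^ 2" using k_powers(1) k1 by linarith
      also note big
      finally have less: "card ?D < card (A `` {x i} - ?U)" .
      have "finite ?D" using finite_sets B(1) exceptional(1) by simp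
      from exists_not_in[OF this less] obtain z where z: "z \<in> A `` {x i} - ?U" "z \<notin> ?D" by blast
      have zV: "z \<in> V" using z AV by auto
      have e: "(w, z) \<in> A \<or> (z, w) \<in> A" using total[of w z] zV w W(1) z(2) by auto
      have "\<exists>l. length l \<le> 1 \<and> walk A (z # l @ [w]) \<and>
          set l \<inter> ((X \<union> Y \<union> F \<union> B) \<union> ?U) = {} \<and> set l \<subseteq> V"
      proof (rule connect[OF P(1) WH _ w(1) w(3)])
        show "w \<noteq> z" using z(2) w by auto
        have "card (X \<union> Y \<union> F \<union> B) \<le> card X + card Y + card F + card B"
          by (meson add_le_mono1 card_Un_le le_trans)
        also have "\<dots> \<le> 561 * k ^ 2 + 5 * k" using card_X card_Y F(2) B(2) by simp
        finally show "card (X \<union> Y \<union> F \<union> B) + 3 * card P \<le> 600 * k ^ 2"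
          using P(2) k_powers(1) k1 by linarith
      qed (use z zV e w finite_sets B(1) in auto)
      then obtain l where l: "length l \<le> 1" "walk A (z # l @ [w])"
        "set l \<inter> ((X \<union> Y \<union> F \<union> B) \<union> ?U) = {}" "set l \<subseteq> V" by blast
      have "Q i (z # l @ [w])" unfolding Q_def
        using False l z w w0 zV W(1) by (auto simp: walk_Cons)
      moreover have "set (z # l @ [w]) \<inter> B = {}" using l(3) z(2) w(2) by auto
      ultimately show ?thesis using l(1) by (intro exI[of _ "z # l @ [w]"]) auto
    qed
  qed simp
  then show ?thesis unfolding Q_def Ball_def lessThan_iff .
qed

text \<open>The reserved vertices on the paths to \<open>Z\<close> are exactly the selected ones:
  spaced, never first, outside \<open>Z\<close> and without crossings. So
  \<open>linkage_after_deletion\<close> provides \<open>k\<close> paths to \<open>Y\<close> after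
  all reserved vertices are removed.\<close>

lemma reservation:
  shows "\<exists>r P'. (\<forall>i<k. r i \<noteq> [] \<and> length (r i) \<le> 3 \<and> last (r i) \<in> W0 \<and> set (r i) \<subseteq> V - X - Y \<and>
      walk A (x i # r i)) \<and>
    (\<forall>i<k. \<forall>j<k. i \<noteq> j \<longrightarrow> set (r i) \<inter> set (r j) = {}) \<and>
    (\<exists>R H. R = (\<Union>i<k. set (r i)) \<and> H = V - X - R \<and>
      min_linkage (A \<inter> H \<times> H) (W - R) Y P' \<and> card P' = k)"
proof -
  let ?H = "V - X"
  obtain P where P: "min_linkage (A \<inter> ?H \<times> ?H) W Z P" "card P = k + 1" using Z_linkage by blast
  have L: "linkage (A \<inter> ?H \<times> ?H) W Z P" and finP: "finite P"
    using P by (auto simp: min_linkage_def linkage_def)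
  have WH: "W \<subseteq> ?H" using W by auto
  let ?U = "\<Union>p\<in>P. set p"
  define I where "I = {i. i < k \<and> card (A `` {x i} - ?U) < 2000 * k ^ 2}"
  obtain \<pi> \<sigma> where ps: "\<And>i. i \<in> I \<Longrightarrow> \<pi> i \<in> P \<and> 2 \<le> \<sigma> i \<and> \<sigma> i < length (\<pi> i) \<and>
        (x i, \<pi> i ! \<sigma> i) \<in> A \<and> \<pi> i ! \<sigma> i \<notin> Y \<union> F \<union> Z"
      and same: "\<And>i j. i \<in> I \<Longrightarrow> j \<in> I \<Longrightarrow> i \<noteq> j \<Longrightarrow> \<pi> i = \<pi> j \<Longrightarrow> \<not> (\<sigma> i \<le> \<sigma> j + 1 \<and> \<sigma> j \<le> \<sigma> i + 1)"
      and diff: "\<And>i j. i \<in> I \<Longrightarrow> j \<in> I \<Longrightarrow> \<pi> i \<noteq> \<pi> j \<Longrightarrow> \<not> crossing A (\<pi> i) (\<sigma> i) (\<pi> j) (\<sigma> j)"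
    using bad_selection[OF P I_def] by blast
  obtain l where l0: "\<forall>i<k. length (l i) \<le> 3 \<and> l i \<noteq> [] \<and> last (l i) \<in> W0 \<and>
      set (l i) \<subseteq> V - X - Y - F - ?U \<and> (if i \<in> I then length (l i) = 1 else walk A (x i # l i))"
    and ldis0: "\<forall>i<k. \<forall>j<k. i \<noteq> j \<longrightarrow> set (l i) \<inter> set (l j) = {}"
    using reservation_lists[OF P I_def] by (elim exE conjE) (rule that)
  note l = l0[rule_format] and ldis = ldis0[rule_format]
  \<comment> \<open>For \<open>i \<in> I\<close>, the selected vertex precedes the single vertex of
    \<open>l i\<close>.\<close>
  define r where "r i = (if i \<in> I then [\<pi> i ! \<sigma> i] else []) @ l i" for i
  define R where "R = (\<Union>i<k. set (r i))"
  have IK: "i < k" if "i \<in> I" for i using that by (simp add: I_def)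
  have bU: "\<pi> i ! \<sigma> i \<in> ?U" if "i \<in> I" for i
    using ps[OF that] by (intro UN_I[of "\<pi> i"]) auto
  have UH: "?U \<subseteq> ?H" using linkage_set_subset[OF L WH] by blast
  have distP: "distinct p" if "p \<in> P" for p using L that by (auto simp: linkage_def dpath_def)
  have pos: "p = q \<and> s = t" if "p \<in> P" "q \<in> P" "s < length p" "t < length q" "p ! s = q ! t" for p q s t
  proof -
    have "p ! s \<in> set p" "q ! t \<in> set q" using that(3,4) by auto
    then have "p ! s \<in> set p \<inter> set q" using that(5) by auto
    then have "p = q" using L that(1,2) unfolding linkage_def by blast
    then show ?thesis using that distP by (auto simp: nth_eq_iff_index_eq)
  qed
  have setr: "set (r i) \<subseteq> V - X - Y - F" if "i < k" for i
    using l[OF that] ps[of i] bU[of i] UH by (auto simp: r_def)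
  have RU: "\<exists>i\<in>I. v = \<pi> i ! \<sigma> i" if v: "v \<in> R" "v \<in> ?U" for v
  proof -
    obtain i where i: "i < k" "v \<in> set (r i)" using v(1) by (auto simp: R_def)
    moreover have "v \<notin> set (l i)" using l[OF i(1)] v(2) by blast
    ultimately show ?thesis by (auto simp: r_def split: if_splits)
  qed
  have RP: "\<exists>i\<in>I. \<pi> i = p \<and> \<sigma> i = s" if p: "p \<in> P" "s < length p" "p ! s \<in> R" for p s
  proof -
    have "p ! s \<in> ?U" using p by (intro UN_I[of p]) auto
    then obtain i where i: "i \<in> I" "p ! s = \<pi> i ! \<sigma> i" using RU[OF p(3)] by blast
    then show ?thesis using pos[of p "\<pi> i" s "\<sigma> i"] ps[OF i(1)] p by blast
  qed
  have rdis: "set (r i) \<inter> set (r j) = {}" if ij: "i < k" "j < k" "i \<noteq> j" for i j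
  proof -
    have "\<pi> i ! \<sigma> i \<noteq> \<pi> j ! \<sigma> j" if I: "i \<in> I" "j \<in> I"
    proof
      assume "\<pi> i ! \<sigma> i = \<pi> j ! \<sigma> j"
      then have "\<pi> i = \<pi> j" "\<sigma> i = \<sigma> j" using pos[of "\<pi> i" "\<pi> j" "\<sigma> i" "\<sigma> j"] ps[OF I(1)] ps[OF I(2)] by auto
      then show False using same[OF I ij(3)] by simp
    qed
    moreover have "\<pi> i ! \<sigma> i \<notin> set (l j)" if "i \<in> I" using bU[OF that] l[OF ij(2)] by blast
    moreover have "\<pi> j ! \<sigma> j \<notin> set (l i)" if "j \<in> I" using bU[OF that] l[OF ij(1)] by blast
    ultimately show ?thesis using ldis[OF ij] by (auto simp: r_def)
  qed
  have rlen: "length (r i) \<le> 3" if "i < k" for i using l[OF that] by (auto simp: r_def)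
  have rwalk: "walk A (x i # r i)" if i: "i < k" for i
  proof (cases "i \<in> I")
    case False
    then show ?thesis using l[OF i] by (simp add: r_def)
  next
    case True
    let ?b = "\<pi> i ! \<sigma> i"
    obtain w where w: "l i = [w]" using l[OF i] True by (auto simp: length_Suc_conv)
    have wW: "w \<in> W" "w \<notin> ?U" using l[OF i] w by (auto simp: W0_def)
    \<comment> \<open>\<open>?b\<close> has position at least 2, so by minimality the free source
      \<open>w\<close> has no arc to it, and semicompleteness gives the opposite arc.\<close>
    have "(w, ?b) \<notin> A"
    proof
      assume "(w, ?b) \<in> A"
      then have "(w, ?b) \<in> A \<inter> ?H \<times> ?H" using wW(1) WH bU[OF True] UH by blast
      then have "\<sigma> i \<le> 1" using min_linkage_arc_index[OF P(1) _ _ wW] ps[OF True] by blast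
      then show False using ps[OF True] by simp
    qed
    moreover have "w \<noteq> ?b" "w \<in> V" "?b \<in> V" using wW bU[OF True] UH WH by blast+
    ultimately have "(?b, w) \<in> A" using total by blast
    then show ?thesis using ps[OF True] True w by (simp add: r_def walk_Cons)
  qed
  have ZU: "Z \<subseteq> ?U"
  proof
    fix z assume z: "z \<in> Z"
    obtain p where p: "\<forall>t\<in>Z. p t \<in> P \<and> last (p t) = t"
      using linkage_ends[OF L] P(2) Z(2) finite_sets by auto
    then have "p z \<noteq> []" using z L by (auto simp: linkage_def dpath_def)
    then have "z \<in> set (p z)" using p z last_in_set by metis
    then show "z \<in> ?U" using p z by blast
  qed
  have cR: "card R \<le> 3 * k"
  proof -
    have "card R \<le> (\<Sum>i<k. card (set (r i)))" unfolding R_def by (rule card_UN_le) simp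
    also have "\<dots> \<le> (\<Sum>i<k. 3)" using rlen card_length le_trans by (intro sum_mono) blast
    finally show ?thesis by simp
  qed
  have RV: "R \<subseteq> V - X - Y - F" using setr by (auto simp: R_def)
  have "\<exists>P'. linkage (A \<inter> (?H - R) \<times> (?H - R)) (W - R) Y P' \<and> card P' = k"
  proof (rule linkage_after_deletion[OF A TA T k1 X(3) _ refl _ L P(2) WH _ Z])
    show "card X \<le> k" using card_X by simp
    show "4 * k < card W" using W(2) k1 by simp
    show "R \<subseteq> V - X" using RV by auto
    show "card R \<le> 3 * k" by (rule cR)
    show "R \<inter> Z = {}"
    proof (rule ccontr)
      assume "R \<inter> Z \<noteq> {}"
      then obtain z where z: "z \<in> R" "z \<in> Z" by blast
      then obtain i where "i \<in> I" "z = \<pi> i ! \<sigma> i" using RU[of z] ZU by blast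
      then show False using ps[of i] z(2) by blast
    qed
    show "Y \<subseteq> V - X - R" using Y(3) XY RV by blast
    show "card Y = k" by (rule card_Y)
    fix S a b assume S: "S \<subseteq> V - X" "card S < k" "a \<in> V - X - S" "b \<in> V - X - S" "a \<noteq> b"
    then show "\<exists>p. path_avoiding V A (S \<union> X) a b p" using conn[of S a b] by simp
  next
    fix v assume "v \<in> V" "card (A\<inverse> `` {v}) \<le> 16 * k"
    then show "R \<inter> A\<inverse> `` {v} = {}" using F(3)[of v] RV by blast
  next
    fix p assume p: "p \<in> P"
    show "p ! 0 \<notin> R"
    proof
      assume "p ! 0 \<in> R"
      moreover have "0 < length p" using L p by (auto simp: linkage_def dpath_def)
      ultimately obtain i where "i \<in> I" "\<sigma> i = 0" using RP[OF p, of 0] by blast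
      then show False using ps[of i] by simp
    qed
  next
    fix p s assume p: "p \<in> P" "Suc s < length p" "p ! Suc s \<in> R"
    show "p ! s \<notin> R"
    proof
      assume s: "p ! s \<in> R"
      obtain i where i: "i \<in> I" "\<pi> i = p" "\<sigma> i = Suc s" using RP[OF p] by blast
      obtain j where j: "j \<in> I" "\<pi> j = p" "\<sigma> j = s" using RP[OF p(1) _ s] p(2) by auto
      have "i \<noteq> j" using i j by auto
      then show False using same[OF i(1) j(1)] i j by simp
    qed
  next
    fix p q s t assume pq: "p \<in> P" "q \<in> P" "p \<noteq> q" "s < length p" "t < length q" "p ! s \<in> R" "q ! t \<in> R"
    obtain i where i: "i \<in> I" "\<pi> i = p" "\<sigma> i = s" using RP[OF pq(1,4,6)] by blast
    obtain j where j: "j \<in> I" "\<pi> j = q" "\<sigma> j = t" using RP[OF pq(2,5,7)] by blast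
    show "\<not> crossing A p s q t" using diff[OF i(1) j(1)] i j pq(3) by auto
  qed
  then obtain P' where P': "min_linkage (A \<inter> (?H - R) \<times> (?H - R)) (W - R) Y P'" "card P' = k"
    using min_linkage_exists by metis
  have "r i \<noteq> [] \<and> length (r i) \<le> 3 \<and> last (r i) \<in> W0 \<and> set (r i) \<subseteq> V - X - Y \<and> walk A (x i # r i)"
    if "i < k" for i
    using l[OF that] setr[OF that] rlen[OF that] rwalk[OF that] by (auto simp: r_def)
  then show ?thesis using rdis P' unfolding R_def
    by (intro exI[of _ r] exI[of _ P']) blast
qed

section \<open>Assembling the disjoint paths\<close>

text \<open>Route \<open>i\<close> runs from \<open>x i\<close> through \<open>r i\<close>, a free
  vertex \<open>w\<close> of \<open>W\<close>, an out-neighbour \<open>u\<close> of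
  \<open>w\<close>, at most one more vertex, and then along the path of \<open>P'\<close> that ends
  in \<open>y i\<close>.\<close>

lemma linked:
  "\<exists>Q. (\<forall>i<k. path_avoiding V A {} (x i) (y i) (Q i)) \<and>
    (\<forall>i<k. \<forall>j<k. i \<noteq> j \<longrightarrow> set (Q i) \<inter> set (Q j) = {})"
proof -
  obtain r P' R H where r: "\<And>i. i < k \<Longrightarrow> r i \<noteq> [] \<and> length (r i) \<le> 3 \<and> last (r i) \<in> W0 \<and>
        set (r i) \<subseteq> V - X - Y \<and> walk A (x i # r i)"
      and rdis: "\<And>i j. i < k \<Longrightarrow> j < k \<Longrightarrow> i \<noteq> j \<Longrightarrow> set (r i) \<inter> set (r j) = {}"
      and R: "R = (\<Union>i<k. set (r i))" and H: "H = V - X - R"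
      and M: "min_linkage (A \<inter> H \<times> H) (W - R) Y P'" and P': "card P' = k"
    using reservation by blast
  have L: "linkage (A \<inter> H \<times> H) (W - R) Y P'" and finP: "finite P'"
    using M by (auto simp: min_linkage_def linkage_def)
  have WH: "W - R \<subseteq> H" using W H by auto
  let ?U = "\<Union>p\<in>P'. set p"
  have UH: "?U \<subseteq> H" using linkage_set_subset[OF L WH] by blast
  have finR: "finite R" using R by simp
  have cR: "card R \<le> 3 * k"
  proof -
    have "card R \<le> (\<Sum>i<k. card (set (r i)))" unfolding R by (rule card_UN_le) simp
    also have "\<dots> \<le> (\<Sum>i<k. 3)" using r card_length le_trans by (intro sum_mono) blast
    finally show ?thesis by simp
  qed
  obtain p where p: "\<And>t. t \<in> Y \<Longrightarrow> p t \<in> P' \<and> last (p t) = t"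
    using linkage_ends[OF L] P' card_Y finite_sets by auto
  define q where "q i = p (y i)" for i
  have q: "q i \<in> P'" "last (q i) = y i" if "i < k" for i using p[of "y i"] that Y(1) by (auto simp: q_def)
  have qd: "walk A (q i)" "q i \<noteq> []" "hd (q i) \<in> W - R" "set (q i) \<subseteq> H" if "i < k" for i
  proof -
    have "dpath (A \<inter> H \<times> H) (q i)" "hd (q i) \<in> W - R" using L q(1)[OF that] by (auto simp: linkage_def)
    then show "walk A (q i)" "q i \<noteq> []" "hd (q i) \<in> W - R"
      using walk_mono[of "A \<inter> H \<times> H" "q i" A] by (auto simp: dpath_iff_walk walk_def)
    show "set (q i) \<subseteq> H" using linkage_set_subset[OF L WH q(1)[OF that]] .
  qed
  have qdis: "set (q i) \<inter> set (q j) = {}" if "i < k" "j < k" "i \<noteq> j" for i j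
  proof -
    have "y i \<noteq> y j" using Y(2) that by (auto simp: inj_on_def)
    then have "q i \<noteq> q j" using q[OF that(1)] q[OF that(2)] by metis
    then show ?thesis using L q(1)[OF that(1)] q(1)[OF that(2)] unfolding linkage_def by blast
  qed
  have WU: "card (W \<inter> ?U) \<le> k"
  proof -
    have "W \<inter> ?U \<subseteq> hd ` P'"
    proof
      fix v assume v: "v \<in> W \<inter> ?U"
      then obtain p where "p \<in> P'" "v \<in> set p" by blast
      then obtain s where p: "p \<in> P'" "s < length p" "p ! s = v" by (auto simp: in_set_conv_nth)
      have "v \<in> W - R" using v UH H by blast
      then have "s = 0" using min_linkage_source_index[OF M p(1,2)] p(3) by auto
      then have "v = hd p" using p by (cases p) auto
      then show "v \<in> hd ` P'" using p(1) by blast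
    qed
    then show ?thesis using card_mono[of "hd ` P'" "W \<inter> ?U"] card_image_le[OF finP, of hd] finP P'
      by auto
  qed
  define Q where "Q i l \<longleftrightarrow> walk A (last (r i) # l @ [hd (q i)]) \<and> set l \<subseteq> V - X - R - ?U" for i l
  have "\<exists>l. (\<forall>i\<in>{..<k}. length (l i) \<le> 3 \<and> Q i (l i)) \<and>
      (\<forall>i\<in>{..<k}. \<forall>j\<in>{..<k}. i \<noteq> j \<longrightarrow> set (l i) \<inter> set (l j) = {})"
  proof (rule greedy_disjoint_lists)
    fix i and B :: "'a set" assume i: "i \<in> {..<k}" and B: "finite B" "card B \<le> 3 * card {..<k}"
    let ?a = "last (r i)" and ?t = "hd (q i)"
    have i': "i < k" using i by simp
    have tW: "?t \<in> W" using qd(3)[OF i'] by simp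
    have a: "card (T `` {?a} \<inter> W) > 10 * k" using r[OF i'] by (simp add: W0_def)
    let ?D1 = "R \<union> B \<union> (W \<inter> ?U)"
    have "card ?D1 \<le> card R + card B + card (W \<inter> ?U)"
      by (meson add_le_mono1 card_Un_le le_trans)
    also have "\<dots> \<le> 7 * k" using cR B(2) WU by simp
    also have "\<dots> \<le> 10 * k" by simp
    also note a
    finally have less: "card ?D1 < card (T `` {?a} \<inter> W)" .
    have "finite ?D1" using finR B(1) finite_sets by simp
    from exists_not_in[OF this less] obtain w where w: "(?a, w) \<in> T" "w \<in> W" "w \<notin> R" "w \<notin> B" "w \<notin> ?U"
      by blast
    \<comment> \<open>The out-degree of \<open>w\<close> supplies \<open>u\<close> outside this set.
      Only the first two vertices of each path have to be excluded, since minimality keeps the arcs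
      of \<open>w\<close> off the later ones.\<close>
    let ?D = "X \<union> Y \<union> F \<union> W \<union> R \<union> B \<union> exceptional ?t \<union> (\<Union>p\<in>P'. set (take 2 p))"
    have "card ?D \<le> card X + card Y + card F + card W + card R + card B + card (exceptional ?t)
        + card (\<Union>p\<in>P'. set (take 2 p))"
      by (meson add_le_mono1 card_Un_le le_trans)
    also have "\<dots> \<le> k + k + 561 * k ^ 2 + 100 * k + 3 * k + 3 * k + 1201 * k ^ 2 + 2 * k"
      using card_X card_Y F(2) W(2) cR B(2) exceptional(2)[of ?t] card_UN_take_le[OF finP, of 2] P'
      by (intro add_mono) simp_all
    also have "\<dots> = 110 * k + 1762 * k ^ 2" by simp
    also have "\<dots> < 10000000 * k ^ 4" using k_powers k1 by linarith
    also have "\<dots> = 10 ^ 7 * k ^ 4" by simp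
    also have "\<dots> \<le> card (A `` {w})" using deg[of w] w(2) W(1) by blast
    finally have less: "card ?D < card (A `` {w})" .
    have "finite ?D" using finite_sets finR B(1) exceptional(1) finP by simp
    from exists_not_in[OF this less] obtain u where u: "(w, u) \<in> A" "u \<notin> ?D" by blast
    have uV: "u \<in> V" using u AV by auto
    then have uH: "u \<in> H" using u(2) H by blast
    have wu: "w \<noteq> u" using u(2) w(2) by blast
    have uU: "u \<notin> ?U"
    proof
      assume "u \<in> ?U"
      then obtain p where "p \<in> P'" "u \<in> set p" by blast
      then obtain s where p: "p \<in> P'" "s < length p" "p ! s = u" by (auto simp: in_set_conv_nth)
      have "(w, p ! s) \<in> A \<inter> H \<times> H" using u p w WH uH by blast
      then have "s \<le> 1" using min_linkage_arc_index[OF M p(1,2), of w] w by blast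
      then have "u \<in> set (take 2 p)" using p nth_mem_take[of s 2 p] by auto
      then show False using u(2) p(1) by blast
    qed
    have "\<exists>l. length l \<le> 1 \<and> walk A (u # l @ [?t]) \<and> set l \<inter> ((X \<union> R \<union> B) \<union> ?U) = {} \<and> set l \<subseteq> V"
    proof (rule connect[OF M WH _ _ w(5) uH uU _ wu tW])
      have "card (X \<union> R \<union> B) \<le> card X + card R + card B"
        by (meson add_le_mono1 card_Un_le le_trans)
      also have "\<dots> \<le> 7 * k" using card_X cR B(2) by simp
      finally show "card (X \<union> R \<union> B) + 3 * card P' \<le> 600 * k ^ 2"
        using P' k_powers(1) by linarith
      show "H \<subseteq> V" using H by blast
      show "w \<in> W - R" using w by blast
      show "u \<notin> X \<union> Y \<union> F \<union> W \<union> exceptional ?t" using u(2) by blast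
      show "(w, u) \<in> A \<or> (u, ?t) \<in> A" using u by blast
      show "finite (X \<union> R \<union> B)" using finite_sets finR B(1) by simp
    qed
    then obtain l where l: "length l \<le> 1" "walk A (u # l @ [?t])"
      "set l \<inter> ((X \<union> R \<union> B) \<union> ?U) = {}" "set l \<subseteq> V" by blast
    have "Q i (w # u # l)" unfolding Q_def
    proof
      show "walk A (?a # (w # u # l) @ [?t])" using l(2) u(1) w(1) TA by (auto simp: walk_Cons)
      show "set (w # u # l) \<subseteq> V - X - R - ?U" using l(3,4) w WH H uH uU by auto
    qed
    moreover have "set (w # u # l) \<inter> B = {}" using l(3) w(4) u(2) by auto
    ultimately show "\<exists>l. length l \<le> 3 \<and> set l \<inter> B = {} \<and> Q i l"
      using l(1) by (intro exI[of _ "w # u # l"]) auto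
  qed simp
  then obtain l where l0: "\<forall>i\<in>{..<k}. length (l i) \<le> 3 \<and> Q i (l i)"
    and ldis0: "\<forall>i\<in>{..<k}. \<forall>j\<in>{..<k}. i \<noteq> j \<longrightarrow> set (l i) \<inter> set (l j) = {}"
    by (elim exE conjE) (rule that)
  have l: "walk A (last (r i) # l i @ [hd (q i)]) \<and> set (l i) \<subseteq> V - X - R - ?U" if "i < k" for i
    using l0 that by (simp add: Q_def)
  have ldis: "set (l i) \<inter> set (l j) = {}" if "i < k" "j < k" "i \<noteq> j" for i j
    using ldis0 that by simp
  define f where "f i = (x i # r i) @ l i @ q i" for i
  have fw: "walk A (f i)" "hd (f i) = x i" "last (f i) = y i" if i: "i < k" for i
  proof -
    have lq: "walk A (l i @ q i) \<and> (last (r i), hd (l i @ q i)) \<in> A"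
    proof (cases "l i = []")
      case True
      then show ?thesis using l[OF i] qd[OF i] by (simp add: walk_Cons)
    next
      case False
      then show ?thesis using l[OF i] qd[OF i] by (simp add: walk_Cons walk_append)
    qed
    then show "walk A (f i)" using r[OF i] qd(2)[OF i] unfolding f_def
      by (subst walk_append) auto
    show "hd (f i) = x i" by (simp add: f_def)
    show "last (f i) = y i" using q(2)[OF i] qd(2)[OF i] by (simp add: f_def)
  qed
  have qU: "set (q i) \<subseteq> ?U" if "i < k" for i using q(1)[OF that] by blast
  have rR: "set (r i) \<subseteq> R" if "i < k" for i using R that by blast
  have xX: "x i \<in> X" if "i < k" for i using X(1) that by blast
  have rX: "set (r i) \<inter> X = {}" if "i < k" for i using r[OF that] by blast
  have fV: "set (f i) \<subseteq> V" if i: "i < k" for i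
    using xX[OF i] X(3) r[OF i] l[OF i] qd(4)[OF i] H unfolding f_def by auto
  have fdis: "set (f i) \<inter> set (f j) = {}" if ij: "i < k" "j < k" "i \<noteq> j" for i j
  proof -
    have xx: "x i \<noteq> x j" using X(2) ij by (auto simp: inj_on_def)
    have out: "x i' \<notin> set (r j') \<union> set (l j') \<union> set (q j')" if "i' < k" "j' < k" for i' j'
      using xX[OF that(1)] rX[OF that(2)] l[OF that(2)] qd(4)[OF that(2)] H by blast
    have rl: "set (r i') \<inter> (set (l j') \<union> set (q j')) = {}" if "i' < k" "j' < k" for i' j'
      using rR[OF that(1)] l[OF that(2)] qd(4)[OF that(2)] H by blast
    have lq: "set (l i') \<inter> set (q j') = {}" if "i' < k" "j' < k" for i' j'
      using l[OF that(1)] qU[OF that(2)] by blast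
    have s: "set (f i) = insert (x i) (set (r i) \<union> set (l i) \<union> set (q i))" for i by (auto simp: f_def)
    show ?thesis unfolding s
      using xx out[OF ij(1,2)] out[OF ij(2,1)] rl[OF ij(1,2)] rl[OF ij(2,1)] lq[OF ij(1,2)] lq[OF ij(2,1)]
        rdis[OF ij] ldis[OF ij] qdis[OF ij] by blast
  qed
  \<comment> \<open>Repetitions within a single \<open>f i\<close> have not been excluded, so a path
    is extracted inside its vertex set.\<close>
  have "\<exists>g. path_avoiding V A {} (x i) (y i) g \<and> set g \<subseteq> set (f i)" if "i < k" for i
    using walk_imp_dpath[OF fw(1)[OF that]] fw(2,3)[OF that] fV[OF that]
    unfolding path_avoiding_def by auto
  then obtain g where g: "\<And>i. i < k \<Longrightarrow> path_avoiding V A {} (x i) (y i) (g i) \<and> set (g i) \<subseteq> set (f i)"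
    by metis
  then show ?thesis using fdis by (intro exI[of _ g]) blast
qed

end

section \<open>Choosing the auxiliary sets for given terminals\<close>

theorem theorem3:
  fixes k :: nat and V :: "'a set" and A :: "('a \<times> 'a) set"
  assumes "k \<ge> 1"
    and "semicomplete V A"
    and "k_connected (2 * k + 1) V A"
    and "min_out_degree V A \<ge> 10 ^ 7 * k ^ 4"
  shows "k_linked k V A"
  unfolding k_linked_def
proof (intro allI impI, elim conjE)
  fix x y :: "nat \<Rightarrow> 'a"
  assume xy: "\<forall>i<k. x i \<in> V \<and> y i \<in> V" and inj: "inj_on (\<lambda>j. if j < k then x j else y (j - k)) {..<2 * k}"
  have finV: "finite V" and AV: "A \<subseteq> V \<times> V" using assms(2) by (auto simp: semicomplete_def digraph_def)
  define X Y where "X = x ` {..<k}" and "Y = y ` {..<k}"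
  have injx: "inj_on x {..<k}"
  proof (rule inj_onI)
    fix i j assume "i \<in> {..<k}" "j \<in> {..<k}" "x i = x j"
    then show "i = j" using inj_onD[OF inj, of i j] by simp
  qed
  have injy: "inj_on y {..<k}"
  proof (rule inj_onI)
    fix i j assume "i \<in> {..<k}" "j \<in> {..<k}" "y i = y j"
    \<comment> \<open>Position \<open>k + i\<close> of the combined tuple holds
      \<open>y i\<close>.\<close>
    then show "i = j" using inj_onD[OF inj, of "k + i" "k + j"] by simp
  qed
  have XY: "X \<inter> Y = {}"
  proof (rule ccontr)
    assume "X \<inter> Y \<noteq> {}"
    then obtain i j where "i < k" "j < k" "x i = y j" by (auto simp: X_def Y_def)
    then show False using inj_onD[OF inj, of i "k + j"] by simp
  qed
  have XV: "X \<subseteq> V" "Y \<subseteq> V" using xy by (auto simp: X_def Y_def)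
  have cX: "card X = k" "card Y = k" using injx injy by (simp_all add: X_def Y_def card_image)
  have finX: "finite X" "finite Y" by (simp_all add: X_def Y_def)
  obtain T where T: "T \<subseteq> A" "tournament V T" using semicomplete_tournament[OF assms(2)] by blast
  have deg: "10 ^ 7 * k ^ 4 \<le> card (A `` {v})" if "v \<in> V" for v
  proof -
    have "{w \<in> V. (v, w) \<in> A} = A `` {v}" using AV by auto
    then have "out_degree V A v = card (A `` {v})" by (simp add: out_degree_def)
    moreover have "min_out_degree V A \<le> out_degree V A v"
      unfolding min_out_degree_def using finV that by (intro Min_le) auto
    ultimately show ?thesis using assms(4) by linarith
  qed
  have kp: "k \<le> k ^ 2" "k ^ 2 \<le> k ^ 4"
    using assms(1) power_increasing[of 1 2 k] power_increasing[of 2 4 k] by simp_all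
  have cV: "10000000 * k ^ 4 \<le> card V"
  proof -
    have "V \<noteq> {}" using XV cX assms(1) by auto
    then obtain v where v: "v \<in> V" by blast
    have "card (A `` {v}) \<le> card V" using AV by (intro card_mono[OF finV]) auto
    then show ?thesis using deg[OF v] by simp
  qed
  let ?Low = "{v \<in> V. card (A\<inverse> `` {v}) \<le> 16 * k}"
  define F where "F = (\<Union>v\<in>?Low. A\<inverse> `` {v})"
  have finA: "finite A" using AV finV finite_subset by blast
  have finF: "finite F" unfolding F_def using finV finA by (auto simp: finite_Image)
  \<comment> \<open>At most \<open>33 * k\<close> vertices have in-degree at most
    \<open>16 * k\<close>, and each contributes at most \<open>16 * k\<close> in-neighbours,
    \<open>528 * k ^ 2\<close> in all.\<close>
  have cF: "card F \<le> 561 * k ^ 2"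
  proof -
    have "?Low \<subseteq> {v \<in> V. card (T\<inverse> `` {v} \<inter> V) \<le> 16 * k}"
    proof
      fix v assume v: "v \<in> ?Low"
      have "card (T\<inverse> `` {v} \<inter> V) \<le> card (A\<inverse> `` {v})"
        using T(1) finA by (intro card_mono) (auto simp: finite_Image)
      then show "v \<in> {v \<in> V. card (T\<inverse> `` {v} \<inter> V) \<le> 16 * k}" using v by simp
    qed
    then have "card ?Low \<le> card {v \<in> V. card (T\<inverse> `` {v} \<inter> V) \<le> 16 * k}"
      using finV by (intro card_mono) auto
    also have "\<dots> \<le> 2 * (16 * k) + 1"
      by (intro tournament_card_low_out_degree[OF tournament_converse[OF T(2)]]) simp
    finally have low: "card ?Low \<le> 33 * k" using assms(1) by linarith
    have "card F \<le> (\<Sum>v\<in>?Low. card (A\<inverse> `` {v}))" unfolding F_def using finV by (intro card_UN_le) auto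
    also have "\<dots> \<le> (\<Sum>v\<in>?Low. 16 * k)" by (intro sum_mono) auto
    also have "\<dots> = card ?Low * (16 * k)" by simp
    also have "\<dots> \<le> (33 * k) * (16 * k)" by (rule mult_le_mono1[OF low])
    also have "\<dots> \<le> 561 * k ^ 2" by (simp add: power2_eq_square)
    finally show ?thesis .
  qed
  have cH: "card (V - X) = card V - k" using XV cX finX by (simp add: card_Diff_subset)
  have "k + 1 \<le> card (V - X)" using cH cV kp assms(1) by linarith
  from exists_lowest_subset[OF _ this, of "\<lambda>v. card (T\<inverse> `` {v} \<inter> (V - X))"]
  obtain Z where Z: "Z \<subseteq> V - X" "card Z = k + 1"
    "\<And>z v. z \<in> Z \<Longrightarrow> v \<in> V - X - Z \<Longrightarrow>
       card (T\<inverse> `` {z} \<inter> (V - X)) \<le> card (T\<inverse> `` {v} \<inter> (V - X))"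
    using finV by auto
  have "100 * k \<le> card (V - (X \<union> Y \<union> F))"
  proof -
    have "card (X \<union> Y \<union> F) \<le> card X + card Y + card F" by (meson add_le_mono1 card_Un_le le_trans)
    then have c: "card (X \<union> Y \<union> F) \<le> 2 * k + 561 * k ^ 2" using cX cF by simp
    have "card V - card (X \<union> Y \<union> F) \<le> card (V - (X \<union> Y \<union> F))"
      using finX finF by (intro diff_card_le_card_Diff) auto
    then show ?thesis using c cV kp assms(1) by linarith
  qed
  from exists_lowest_subset[OF _ this, of "\<lambda>v. card (T `` {v})"]
  obtain W where W: "W \<subseteq> V - (X \<union> Y \<union> F)" "card W = 100 * k"
    "\<And>w v. w \<in> W \<Longrightarrow> v \<in> V - (X \<union> Y \<union> F) - W \<Longrightarrow> card (T `` {w}) \<le> card (T `` {v})"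
    using finV by auto
  interpret linking k V A T x y X Y F Z W
  proof
    fix S a b assume S: "S \<subseteq> V - X" "card S \<le> k" "a \<in> V - X - S" "b \<in> V - X - S" "a \<noteq> b"
    \<comment> \<open>Together these are \<open>2 * k\<close> vertices at most, the largest number
      whose deletion \<open>(2 * k + 1)\<close>-connectivity tolerates.\<close>
    have "card (S \<union> X) \<le> 2 * k + 1 - 1" using card_Un_le[of S X] S(2) cX by linarith
    moreover have "S \<union> X \<subseteq> V" using S(1) XV by blast
    moreover have "a \<in> V - (S \<union> X)" "b \<in> V - (S \<union> X)" using S by auto
    ultimately show "\<exists>p. path_avoiding V A (S \<union> X) a b p"
      using assms(3) S(5) unfolding k_connected_def by blast
  next
    fix v assume "v \<in> V" "card (A\<inverse> `` {v}) \<le> 16 * k"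
    then show "A\<inverse> `` {v} \<subseteq> F" unfolding F_def by blast
  qed (use assms T deg X_def Y_def injx injy XV XY finF cF Z W in \<open>simp_all\<close>)
  show "\<exists>P. (\<forall>i<k. path_avoiding V A {} (x i) (y i) (P i)) \<and>
      (\<forall>i<k. \<forall>j<k. i \<noteq> j \<longrightarrow> set (P i) \<inter> set (P j) = {})"
    by (rule linked)
qed

end
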